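(* Let $\mathcal A$ be a category and $(\mathrm{CoFib},\mathrm{Fib},\mathrm{Weq})$ an orthogonal model structure on $\mathcal A$ such that $\mathcal A$ has enough cofibrant objects and enough fibrant objects with respect to it. Let $\mathcal C$ (respectively, $\mathcal F$) be the full subcategory of cofibrant (respectively, fibrant) objects. Then the restriction of the localization functor $\mathcal A\longrightarrow \mathrm{Ho}(\mathcal A)$ to $\mathcal C\cap\mathcal F$ is an equivalence of categories $\mathcal C\cap\mathcal F\simeq \mathrm{Ho}(\mathcal A)$.
   Context: A class $\mathcal S$ of morphisms has the two-out-of-three property if for composable $f,g$, whenever two of $f,g,g\circ f$ lie in $\mathcal S$, so does the third. A model structure on a category $\mathcal A$ is a triple $(\mathrm{CoFib},\mathrm{Fib},\mathrm{Weq})$ of classes of morphisms (cofibrations, fibrations, weak equivalences) such that, with $\mathrm{TCoFib}:=\mathrm{CoFib}\cap\mathrm{Weq}$ (trivial cofibrations) and $\mathrm{TFib}:=\mathrm{Fib}\cap\mathrm{Weq}$ (trivial fibrations): (CM1) $\mathrm{Weq}$ has the two-out-of-three property; (CM2) the three classes are closed under retracts; (CM3) for every commutative square $p\circ a=b\circ i$ with $i:A\to B$, $p:X\to Y$, $a:A\to X$, $b:B\to Y$, and either $i\in\mathrm{TCoFib}$, $p\in\mathrm{Fib}$ or $i\in\mathrm{CoFib}$, $p\in\mathrm{TFib}$, there is a lifting $s:B\to X$ with $s\circ i=a$, $p\circ s=b$; (CM4) every morphism factors as $p\circ i$ with $i\in\mathrm{TCoFib}$, $p\in\mathrm{Fib}$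 and as $q\circ j$ with $j\in\mathrm{CoFib}$, $q\in\mathrm{TFib}$. No limits or colimits of $\mathcal A$ are assumed. The model structure is orthogonal if the lifting in (CM3) is always unique. $\mathrm{Ho}(\mathcal A):=\mathcal A[\mathrm{Weq}^{-1}]$ is the localization of $\mathcal A$ at $\mathrm{Weq}$. Cofibrant and fibrant objects (no initial or terminal object is needed): an object $C$ is cofibrant if for every trivial fibration $p:X\to Y$ and every $u:C\to Y$ there is a unique $v:C\to X$ with $p\circ v=u$; an object $F$ is fibrant if for every trivial cofibration $i:X\to Y$ and every $u:X\to F$ there is a unique $v:Y\to F$ with $v\circ i=u$. $\mathcal A$ has enough cofibrant objects if for every object $A$ there is a trivial fibration $C\to A$ with $C$ cofibrant; it has enough fibrant objects if for every object $A$ there is a trivial cofibration $A\to F$ with $F$ fibrant. *)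

theory Defs
  imports Main
begin

section \<open>Categories and functors\<close>

record ('o, 'm) cat =
  Obj :: "'o set"
  Arr :: "'m set"
  Dom :: "'m \<Rightarrow> 'o"
  Cod :: "'m \<Rightarrow> 'o"
  Id :: "'o \<Rightarrow> 'm"
  Comp :: "'m \<Rightarrow> 'm \<Rightarrow> 'm"  (infixr "\<cdot>\<index>" 70)

text \<open>\<open>g \<cdot>\<^bsub>C\<^esub> f\<close> means ``first \<open>f\<close>, then \<open>g\<close>''; values of the operations outside
  the carriers, or on non-composable pairs, are irrelevant.\<close>

definition Hom :: "('o, 'm) cat \<Rightarrow> 'o \<Rightarrow> 'o \<Rightarrow> 'm set" where
  "Hom C X Y = {f \<in> Arr C. Dom C f = X \<and> Cod C f = Y}"

locale category =
  fixes C :: "('o, 'm) cat" (structure)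
  assumes Dom_Obj: "f \<in> Arr C \<Longrightarrow> Dom C f \<in> Obj C"
    and Cod_Obj: "f \<in> Arr C \<Longrightarrow> Cod C f \<in> Obj C"
    and Id_Hom: "X \<in> Obj C \<Longrightarrow> Id C X \<in> Hom C X X"
    and Comp_Hom: "f \<in> Hom C X Y \<Longrightarrow> g \<in> Hom C Y Z \<Longrightarrow> g \<cdot> f \<in> Hom C X Z"
    and Comp_Id: "f \<in> Hom C X Y \<Longrightarrow> f \<cdot> Id C X = f"
    and Id_Comp: "f \<in> Hom C X Y \<Longrightarrow> Id C Y \<cdot> f = f"
    and Comp_assoc: "f \<in> Hom C W X \<Longrightarrow> g \<in> Hom C X Y \<Longrightarrow> h \<in> Hom C Y Z \<Longrightarrow>
      (h \<cdot> g) \<cdot> f = h \<cdot> (g \<cdot> f)"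

definition inverse_pair :: "('o, 'm) cat \<Rightarrow> 'm \<Rightarrow> 'm \<Rightarrow> bool" where
  "inverse_pair C f g \<longleftrightarrow> f \<in> Arr C \<and> g \<in> Hom C (Cod C f) (Dom C f) \<and>
     g \<cdot>\<^bsub>C\<^esub> f = Id C (Dom C f) \<and> f \<cdot>\<^bsub>C\<^esub> g = Id C (Cod C f)"

definition is_iso :: "('o, 'm) cat \<Rightarrow> 'm \<Rightarrow> bool" where
  "is_iso C f \<longleftrightarrow> (\<exists>g. inverse_pair C f g)"

definition full_subcategory :: "('o, 'm) cat \<Rightarrow> 'o set \<Rightarrow> ('o, 'm) cat" where
  "full_subcategory C S = \<lparr>Obj = Obj C \<inter> S, Arr = {f \<in> Arr C. Dom C f \<in> S \<and> Cod C f \<in> S},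
     Dom = Dom C, Cod = Cod C, Id = Id C, Comp = Comp C\<rparr>"

record ('o, 'm, 'p, 'n) functor_data =
  on_Obj :: "'o \<Rightarrow> 'p"
  on_Arr :: "'m \<Rightarrow> 'n"

text \<open>Source and target are not part of the data, so the restriction of \<open>F : A \<rightarrow> B\<close> to a
  subcategory \<open>A'\<close> of \<open>A\<close> is the same record \<open>F\<close>, regarded as a functor from \<open>A'\<close> to \<open>B\<close>.\<close>

locale is_functor = A: category A + B: category B
  for A :: "('o, 'm) cat" and B :: "('p, 'n) cat" +
  fixes F :: "('o, 'm, 'p, 'n) functor_data"
  assumes on_Obj_Obj: "X \<in> Obj A \<Longrightarrow> on_Obj F X \<in> Obj B"
    and on_Arr_Hom: "f \<in> Hom A X Y \<Longrightarrow> on_Arr F f \<in> Hom B (on_Obj F X) (on_Obj F Y)"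
    and on_Arr_Id: "X \<in> Obj A \<Longrightarrow> on_Arr F (Id A X) = Id B (on_Obj F X)"
    and on_Arr_Comp: "f \<in> Hom A X Y \<Longrightarrow> g \<in> Hom A Y Z \<Longrightarrow>
      on_Arr F (g \<cdot>\<^bsub>A\<^esub> f) = on_Arr F g \<cdot>\<^bsub>B\<^esub> on_Arr F f"

definition id_functor :: "('o, 'm, 'o, 'm) functor_data" where
  "id_functor = \<lparr>on_Obj = (\<lambda>X. X), on_Arr = (\<lambda>f. f)\<rparr>"

definition comp_functor ::
  "('p, 'n, 'q, 'k) functor_data \<Rightarrow> ('o, 'm, 'p, 'n) functor_data \<Rightarrow> ('o, 'm, 'q, 'k) functor_data"
  where "comp_functor G F =
    \<lparr>on_Obj = (\<lambda>X. on_Obj G (on_Obj F X)), on_Arr = (\<lambda>f. on_Arr G (on_Arr F f))\<rparr>"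

definition natural_isomorphism ::
  "('o, 'm) cat \<Rightarrow> ('p, 'n) cat \<Rightarrow> ('o, 'm, 'p, 'n) functor_data \<Rightarrow>
   ('o, 'm, 'p, 'n) functor_data \<Rightarrow> ('o \<Rightarrow> 'n) \<Rightarrow> bool" where
  "natural_isomorphism A B F G \<tau> \<longleftrightarrow> is_functor A B F \<and> is_functor A B G \<and>
     (\<forall>X \<in> Obj A. \<tau> X \<in> Hom B (on_Obj F X) (on_Obj G X) \<and> is_iso B (\<tau> X)) \<and>
     (\<forall>f \<in> Arr A. \<tau> (Cod A f) \<cdot>\<^bsub>B\<^esub> on_Arr F f = on_Arr G f \<cdot>\<^bsub>B\<^esub> \<tau> (Dom A f))"

definition is_equivalence ::
  "('o, 'm) cat \<Rightarrow> ('p, 'n) cat \<Rightarrow> ('o, 'm, 'p, 'n) functor_data \<Rightarrow> bool" where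
  "is_equivalence A B F \<longleftrightarrow> is_functor A B F \<and>
     (\<exists>G \<eta> \<epsilon>. is_functor B A G \<and>
        natural_isomorphism A A id_functor (comp_functor G F) \<eta> \<and>
        natural_isomorphism B B (comp_functor F G) id_functor \<epsilon>)"


section \<open>Localization at a class of morphisms\<close>

text \<open>The Gabriel--Zisman construction: arrows are zigzags, listed in the order in which they are
  traversed, in which the arrows in \<open>W\<close> may be traversed backwards, modulo the congruence
  \<open>zigzag_eq\<close> for concatenation. The universal property is proved below as
  \<open>localization_factor\<close> and \<open>localization_unique\<close>.\<close>

datatype 'm step = Fwd 'm | Bwd 'm

fun zigzag :: "('o, 'm) cat \<Rightarrow> 'm set \<Rightarrow> 'o \<Rightarrow> 'm step list \<Rightarrow> 'o \<Rightarrow> bool" where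
  "zigzag A W X [] Y \<longleftrightarrow> X \<in> Obj A \<and> X = Y"
| "zigzag A W X (Fwd f # p) Y \<longleftrightarrow> f \<in> Arr A \<and> Dom A f = X \<and> zigzag A W (Cod A f) p Y"
| "zigzag A W X (Bwd w # p) Y \<longleftrightarrow> w \<in> W \<and> Cod A w = X \<and> zigzag A W (Dom A w) p Y"

inductive zigzag_eq ::
  "('o, 'm) cat \<Rightarrow> 'm set \<Rightarrow> 'o \<Rightarrow> 'o \<Rightarrow> 'm step list \<Rightarrow> 'm step list \<Rightarrow> bool"
  for A W where
  zz_refl: "zigzag A W X p Y \<Longrightarrow> zigzag_eq A W X Y p p"
| zz_sym: "zigzag_eq A W X Y p q \<Longrightarrow> zigzag_eq A W X Y q p"
| zz_trans: "zigzag_eq A W X Y p q \<Longrightarrow> zigzag_eq A W X Y q r \<Longrightarrow> zigzag_eq A W X Y p r"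
| zz_append: "zigzag_eq A W X Y p p' \<Longrightarrow> zigzag_eq A W Y Z q q' \<Longrightarrow>
    zigzag_eq A W X Z (p @ q) (p' @ q')"
| zz_id: "X \<in> Obj A \<Longrightarrow> zigzag_eq A W X X [Fwd (Id A X)] []"
| zz_comp: "f \<in> Hom A X Y \<Longrightarrow> g \<in> Hom A Y Z \<Longrightarrow>
    zigzag_eq A W X Z [Fwd f, Fwd g] [Fwd (g \<cdot>\<^bsub>A\<^esub> f)]"
| zz_inv_left: "w \<in> W \<Longrightarrow> zigzag_eq A W (Dom A w) (Dom A w) [Fwd w, Bwd w] []"
| zz_inv_right: "w \<in> W \<Longrightarrow> zigzag_eq A W (Cod A w) (Cod A w) [Bwd w, Fwd w] []"

definition zigzag_class ::
  "('o, 'm) cat \<Rightarrow> 'm set \<Rightarrow> 'o \<Rightarrow> 'o \<Rightarrow> 'm step list \<Rightarrow> 'o \<times> 'm step list set \<times> 'o" where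
  "zigzag_class A W X Y p = (X, {q. zigzag_eq A W X Y p q}, Y)"

definition localization ::
  "('o, 'm) cat \<Rightarrow> 'm set \<Rightarrow> ('o, 'o \<times> 'm step list set \<times> 'o) cat" where
  "localization A W = \<lparr>Obj = Obj A,
     Arr = {zigzag_class A W X Y p | X Y p. zigzag A W X p Y},
     Dom = (\<lambda>(X, P, Y). X),
     Cod = (\<lambda>(X, P, Y). Y),
     Id = (\<lambda>X. zigzag_class A W X X []),
     Comp = (\<lambda>(Y', Q, Z) (X, P, Y). (X, {r. \<exists>p \<in> P. \<exists>q \<in> Q. zigzag_eq A W X Z (p @ q) r}, Z))\<rparr>"

definition localization_functor ::
  "('o, 'm) cat \<Rightarrow> 'm set \<Rightarrow> ('o, 'm, 'o, 'o \<times> 'm step list set \<times> 'o) functor_data" where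
  "localization_functor A W =
     \<lparr>on_Obj = (\<lambda>X. X), on_Arr = (\<lambda>f. zigzag_class A W (Dom A f) (Cod A f) [Fwd f])\<rparr>"

lemma zigzag_append:
  "zigzag A W X p Y \<Longrightarrow> zigzag A W Y q Z \<Longrightarrow> zigzag A W X (p @ q) Z"
  by (induction A W X p Y rule: zigzag.induct) auto

locale localizing = category A for A :: "('o, 'm) cat" +
  fixes W :: "'m set"
  assumes W_Arr: "W \<subseteq> Arr A"
begin

lemma zigzag_Obj: "zigzag A W X p Y \<Longrightarrow> X \<in> Obj A \<and> Y \<in> Obj A"
proof (induction p arbitrary: X)
  case (Cons s p)
  then show ?case using Dom_Obj Cod_Obj W_Arr by (cases s) auto
qed simp

lemma zigzag_eq_zigzag: "zigzag_eq A W X Y p q \<Longrightarrow> zigzag A W X p Y \<and> zigzag A W X q Y"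
proof (induction rule: zigzag_eq.induct)
  case (zz_append X Y p p' Z q q')
  then show ?case using zigzag_append by metis
next
  case (zz_comp f X Y g Z)
  have "g \<cdot>\<^bsub>A\<^esub> f \<in> Hom A X Z" using zz_comp Comp_Hom by blast
  then show ?case using zz_comp Cod_Obj by (auto simp: Hom_def)
qed (use Id_Hom Dom_Obj Cod_Obj W_Arr in \<open>auto simp: Hom_def\<close>)

lemma zigzag_class_eq_iff:
  assumes "zigzag A W X p Y"
  shows "zigzag_class A W X Y p = zigzag_class A W X' Y' q \<longleftrightarrow>
    X = X' \<and> Y = Y' \<and> zigzag_eq A W X Y p q"
proof
  assume eq: "zigzag_class A W X Y p = zigzag_class A W X' Y' q"
  then have [simp]: "X' = X" "Y' = Y" by (auto simp: zigzag_class_def)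
  have "p \<in> {r. zigzag_eq A W X Y q r}"
    using eq zz_refl[OF assms] by (auto simp: zigzag_class_def)
  then show "X = X' \<and> Y = Y' \<and> zigzag_eq A W X Y p q" by (auto intro: zz_sym)
qed (auto simp: zigzag_class_def intro: zz_sym zz_trans)

lemma Hom_localization:
  "Hom (localization A W) X Y = {zigzag_class A W X Y p | p. zigzag A W X p Y}"
  by (auto simp: Hom_def localization_def zigzag_class_def)

lemma Comp_localization:
  assumes "zigzag A W X p Y" "zigzag A W Y q Z"
  shows "zigzag_class A W Y Z q \<cdot>\<^bsub>localization A W\<^esub> zigzag_class A W X Y p
    = zigzag_class A W X Z (p @ q)"
proof -
  have "{r. \<exists>p' \<in> {r. zigzag_eq A W X Y p r}. \<exists>q' \<in> {r. zigzag_eq A W Y Z q r}.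
      zigzag_eq A W X Z (p' @ q') r} = {r. zigzag_eq A W X Z (p @ q) r}"
    using zz_refl[OF assms(1)] zz_refl[OF assms(2)] by (auto intro: zz_append zz_trans)
  then show ?thesis by (simp add: localization_def zigzag_class_def)
qed

lemma Id_localization: "Id (localization A W) X = zigzag_class A W X X []"
  by (simp add: localization_def)

lemma Obj_localization: "Obj (localization A W) = Obj A"
  by (simp add: localization_def)

lemma category_localization: "category (localization A W)"
proof
  fix f assume "f \<in> Arr (localization A W)"
  then show "Dom (localization A W) f \<in> Obj (localization A W)"
    and "Cod (localization A W) f \<in> Obj (localization A W)"
    by (auto simp: localization_def zigzag_class_def dest: zigzag_Obj)
next
  fix X assume "X \<in> Obj (localization A W)"
  then show "Id (localization A W) X \<in> Hom (localization A W) X X"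
    by (auto simp: Hom_localization Id_localization Obj_localization intro: exI[of _ "[]"])
next
  fix f g X Y Z
  assume "f \<in> Hom (localization A W) X Y" "g \<in> Hom (localization A W) Y Z"
  then show "g \<cdot>\<^bsub>localization A W\<^esub> f \<in> Hom (localization A W) X Z"
    by (auto simp: Hom_localization Comp_localization intro: zigzag_append)
next
  fix f X Y
  assume "f \<in> Hom (localization A W) X Y"
  then obtain p where p: "f = zigzag_class A W X Y p" "zigzag A W X p Y"
    by (auto simp: Hom_localization)
  then have "zigzag A W X [] X" "zigzag A W Y [] Y" by (auto dest: zigzag_Obj)
  then show "f \<cdot>\<^bsub>localization A W\<^esub> Id (localization A W) X = f"
    and "Id (localization A W) Y \<cdot>\<^bsub>localization A W\<^esub> f = f"
    using p by (simp_all add: Id_localization Comp_localization)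
next
  fix f g h V X Y Z
  assume "f \<in> Hom (localization A W) V X" "g \<in> Hom (localization A W) X Y"
    "h \<in> Hom (localization A W) Y Z"
  then show "(h \<cdot>\<^bsub>localization A W\<^esub> g) \<cdot>\<^bsub>localization A W\<^esub> f
    = h \<cdot>\<^bsub>localization A W\<^esub> (g \<cdot>\<^bsub>localization A W\<^esub> f)"
    by (auto simp: Hom_localization Comp_localization zigzag_append)
qed

lemma zigzag_Fwd: "f \<in> Hom A X Y \<Longrightarrow> zigzag A W X [Fwd f] Y"
  using Cod_Obj by (auto simp: Hom_def)

lemma zigzag_Bwd: "w \<in> W \<Longrightarrow> zigzag A W (Cod A w) [Bwd w] (Dom A w)"
  using Dom_Obj W_Arr by auto

lemma on_Arr_localization_functor: "f \<in> Hom A X Y \<Longrightarrow>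
    on_Arr (localization_functor A W) f = zigzag_class A W X Y [Fwd f]"
  by (auto simp: localization_functor_def Hom_def)

lemma is_functor_localization: "is_functor A (localization A W) (localization_functor A W)"
proof (intro is_functor.intro is_functor_axioms.intro)
  show "category A" by unfold_locales
  show "category (localization A W)" by (rule category_localization)
next
  fix X assume X: "X \<in> Obj A"
  then show "on_Obj (localization_functor A W) X \<in> Obj (localization A W)"
    by (simp add: localization_functor_def localization_def)
  show "on_Arr (localization_functor A W) (Id A X)
      = Id (localization A W) (on_Obj (localization_functor A W) X)"
    using on_Arr_localization_functor[OF Id_Hom[OF X]]
      zigzag_class_eq_iff[OF zigzag_Fwd[OF Id_Hom[OF X]], of X X "[]"] zz_id[OF X]
    by (simp add: Id_localization) (simp add: localization_functor_def)
next
  fix f X Y assume f: "f \<in> Hom A X Y"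
  then show "on_Arr (localization_functor A W) f \<in> Hom (localization A W)
      (on_Obj (localization_functor A W) X) (on_Obj (localization_functor A W) Y)"
    using on_Arr_localization_functor[OF f] zigzag_Fwd[OF f]
    by (auto simp: Hom_localization localization_functor_def)
  fix g Z assume g: "g \<in> Hom A Y Z"
  have "zigzag_eq A W X Z ([Fwd f] @ [Fwd g]) [Fwd (g \<cdot>\<^bsub>A\<^esub> f)]"
    using zz_comp[OF f g] by simp
  then show "on_Arr (localization_functor A W) (g \<cdot>\<^bsub>A\<^esub> f) = on_Arr (localization_functor A W) g
      \<cdot>\<^bsub>localization A W\<^esub> on_Arr (localization_functor A W) f"
    using zigzag_class_eq_iff[OF zigzag_append[OF zigzag_Fwd[OF f] zigzag_Fwd[OF g]]]
    by (simp only: on_Arr_localization_functor[OF f] on_Arr_localization_functor[OF g]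
        on_Arr_localization_functor[OF Comp_Hom[OF f g]]
        Comp_localization[OF zigzag_Fwd[OF f] zigzag_Fwd[OF g]]) metis
qed

lemma localization_inverse_pair:
  assumes w: "w \<in> W"
  shows "inverse_pair (localization A W) (on_Arr (localization_functor A W) w)
    (zigzag_class A W (Cod A w) (Dom A w) [Bwd w])"
proof -
  have wH: "w \<in> Hom A (Dom A w) (Cod A w)" using w W_Arr by (auto simp: Hom_def)
  note wF = zigzag_Fwd[OF wH]
  note wB = zigzag_Bwd[OF w]
  have L: "on_Arr (localization_functor A W) w = zigzag_class A W (Dom A w) (Cod A w) [Fwd w]"
    by (rule on_Arr_localization_functor[OF wH])
  have "zigzag_class A W (Dom A w) (Cod A w) [Fwd w] \<in> Hom (localization A W) (Dom A w) (Cod A w)"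
    "zigzag_class A W (Cod A w) (Dom A w) [Bwd w] \<in> Hom (localization A W) (Cod A w) (Dom A w)"
    using wF wB by (auto simp: Hom_localization)
  moreover have "zigzag_class A W (Dom A w) (Dom A w) ([Fwd w] @ [Bwd w])
      = zigzag_class A W (Dom A w) (Dom A w) []"
    using zigzag_class_eq_iff[OF zigzag_append[OF wF wB]] zz_inv_left[OF w] by simp
  moreover have "zigzag_class A W (Cod A w) (Cod A w) ([Bwd w] @ [Fwd w])
      = zigzag_class A W (Cod A w) (Cod A w) []"
    using zigzag_class_eq_iff[OF zigzag_append[OF wB wF]] zz_inv_right[OF w] by simp
  ultimately show ?thesis
    by (simp add: inverse_pair_def L Id_localization Comp_localization[OF wF wB]
        Comp_localization[OF wB wF] Hom_def del: append.simps)
qed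

end

lemma (in category) inverse_pair_unique:
  assumes "inverse_pair C f g" "inverse_pair C f h"
  shows "g = h"
proof -
  have f: "f \<in> Hom C (Dom C f) (Cod C f)"
    and g: "g \<in> Hom C (Cod C f) (Dom C f)" and h: "h \<in> Hom C (Cod C f) (Dom C f)"
    using assms by (auto simp: inverse_pair_def Hom_def)
  have "g = g \<cdot> Id C (Cod C f)" using Comp_Id[OF g] by simp
  also have "\<dots> = g \<cdot> (f \<cdot> h)" using assms by (simp add: inverse_pair_def)
  also have "\<dots> = (g \<cdot> f) \<cdot> h" using Comp_assoc[OF h f g] by simp
  also have "\<dots> = h" using assms Id_Comp[OF h] by (simp add: inverse_pair_def)
  finally show ?thesis .
qed

definition chosen_inverse :: "('o, 'm) cat \<Rightarrow> 'm \<Rightarrow> 'm" where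
  "chosen_inverse C f = (SOME g. inverse_pair C f g)"

fun zigzag_eval :: "('o, 'm) cat \<Rightarrow> ('p, 'n) cat \<Rightarrow> ('o, 'm, 'p, 'n) functor_data \<Rightarrow> 'o \<Rightarrow>
    'm step list \<Rightarrow> 'n" where
  "zigzag_eval A B F X [] = Id B (on_Obj F X)"
| "zigzag_eval A B F X (Fwd f # p) = zigzag_eval A B F (Cod A f) p \<cdot>\<^bsub>B\<^esub> on_Arr F f"
| "zigzag_eval A B F X (Bwd w # p) =
     zigzag_eval A B F (Dom A w) p \<cdot>\<^bsub>B\<^esub> chosen_inverse B (on_Arr F w)"

locale inverting_functor = localizing A W + is_functor A B F
  for A :: "('o, 'm) cat" and W and B :: "('p, 'n) cat" and F +
  assumes W_iso: "w \<in> W \<Longrightarrow> is_iso B (on_Arr F w)"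
begin

lemma inverse_pair_chosen_inverse:
  assumes "w \<in> W"
  shows "inverse_pair B (on_Arr F w) (chosen_inverse B (on_Arr F w))"
  using W_iso[OF assms] unfolding is_iso_def chosen_inverse_def by (rule someI_ex)

lemma W_Hom: "w \<in> W \<Longrightarrow> on_Arr F w \<in> Hom B (on_Obj F (Dom A w)) (on_Obj F (Cod A w))"
  using on_Arr_Hom W_Arr by (auto simp: Hom_def)

lemma chosen_inverse_Hom: "w \<in> W \<Longrightarrow>
    chosen_inverse B (on_Arr F w) \<in> Hom B (on_Obj F (Cod A w)) (on_Obj F (Dom A w))"
  using inverse_pair_chosen_inverse[of w] W_Hom[of w] by (auto simp: inverse_pair_def Hom_def)

lemma zigzag_eval_Hom:
  "zigzag A W X p Y \<Longrightarrow> zigzag_eval A B F X p \<in> Hom B (on_Obj F X) (on_Obj F Y)"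
proof (induction p arbitrary: X)
  case Nil
  then show ?case using B.Id_Hom on_Obj_Obj by auto
next
  case (Cons s p)
  show ?case
  proof (cases s)
    case (Fwd f)
    then have f: "f \<in> Hom A X (Cod A f)" using Cons.prems by (simp add: Hom_def)
    show ?thesis using Cons Fwd B.Comp_Hom[OF on_Arr_Hom[OF f]] by simp
  next
    case (Bwd w)
    then have w: "w \<in> W" "X = Cod A w" using Cons.prems by simp_all
    show ?thesis using Cons Bwd w(2) B.Comp_Hom[OF chosen_inverse_Hom[OF w(1)]] by simp
  qed
qed

lemma zigzag_eval_append:
  "zigzag A W X p Y \<Longrightarrow> zigzag A W Y q Z \<Longrightarrow>
    zigzag_eval A B F X (p @ q) = zigzag_eval A B F Y q \<cdot>\<^bsub>B\<^esub> zigzag_eval A B F X p"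
proof (induction p arbitrary: X)
  case Nil
  then show ?case using B.Comp_Id[OF zigzag_eval_Hom] by auto
next
  case (Cons s p)
  show ?case
  proof (cases s)
    case (Fwd f)
    then have f: "f \<in> Hom A X (Cod A f)" and p: "zigzag A W (Cod A f) p Y"
      using Cons.prems by (simp_all add: Hom_def)
    show ?thesis
      using Cons.IH[OF p Cons.prems(2)] Fwd
        B.Comp_assoc[OF on_Arr_Hom[OF f] zigzag_eval_Hom[OF p] zigzag_eval_Hom[OF Cons.prems(2)]]
      by simp
  next
    case (Bwd w)
    then have w: "w \<in> W" and p: "zigzag A W (Dom A w) p Y" using Cons.prems by simp_all
    show ?thesis
      using Cons.IH[OF p Cons.prems(2)] Bwd
        B.Comp_assoc[OF chosen_inverse_Hom[OF w] zigzag_eval_Hom[OF p]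
          zigzag_eval_Hom[OF Cons.prems(2)]]
      by simp
  qed
qed

lemma zigzag_eval_eq:
  "zigzag_eq A W X Y p q \<Longrightarrow> zigzag_eval A B F X p = zigzag_eval A B F X q"
proof (induction rule: zigzag_eq.induct)
  case (zz_append X Y p p' Z q q')
  then show ?case using zigzag_eval_append zigzag_eq_zigzag by metis
next
  case (zz_id X)
  then show ?case
    using Id_Hom[OF zz_id] on_Arr_Id on_Obj_Obj B.Id_Comp[OF B.Id_Hom] by (auto simp: Hom_def)
next
  case (zz_comp f X Y g Z)
  have gf: "g \<cdot>\<^bsub>A\<^esub> f \<in> Hom A X Z" using zz_comp Comp_Hom by blast
  have "Cod A f = Y" "Cod A g = Z" "Cod A (g \<cdot>\<^bsub>A\<^esub> f) = Z"
    using zz_comp gf by (auto simp: Hom_def)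
  then show ?case
    using B.Id_Comp[OF on_Arr_Hom[OF gf]] B.Id_Comp[OF on_Arr_Hom[OF zz_comp(2)]]
      on_Arr_Comp[OF zz_comp] by simp
next
  case (zz_inv_left w)
  then show ?case
    using B.Id_Comp[OF chosen_inverse_Hom[OF zz_inv_left]] inverse_pair_chosen_inverse[OF zz_inv_left]
      W_Hom[OF zz_inv_left] by (auto simp: inverse_pair_def Hom_def)
next
  case (zz_inv_right w)
  then show ?case
    using B.Id_Comp[OF W_Hom[OF zz_inv_right]] inverse_pair_chosen_inverse[OF zz_inv_right]
      W_Hom[OF zz_inv_right] by (auto simp: inverse_pair_def Hom_def)
qed auto

theorem localization_factor:
  "\<exists>G. is_functor (localization A W) B G \<and>
     (\<forall>X \<in> Obj A. on_Obj (comp_functor G (localization_functor A W)) X = on_Obj F X) \<and>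
     (\<forall>f \<in> Arr A. on_Arr (comp_functor G (localization_functor A W)) f = on_Arr F f)"
proof -
  define G :: "('o, 'o \<times> 'm step list set \<times> 'o, 'p, 'n) functor_data" where
    "G = \<lparr>on_Obj = on_Obj F, on_Arr = (\<lambda>(X, P, Y). zigzag_eval A B F X (SOME p. p \<in> P))\<rparr>"
  have G_Obj: "on_Obj G X = on_Obj F X" for X by (simp add: G_def)
  have G_Arr: "on_Arr G (zigzag_class A W X Y p) = zigzag_eval A B F X p"
    if "zigzag A W X p Y" for X Y p
  proof -
    have "zigzag_eq A W X Y p (SOME q. q \<in> {q. zigzag_eq A W X Y p q})"
      using zz_refl[OF that] by (metis mem_Collect_eq someI)
    then show ?thesis using zigzag_eval_eq by (simp add: G_def zigzag_class_def)
  qed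
  have "is_functor (localization A W) B G"
  proof (intro is_functor.intro is_functor_axioms.intro)
    show "category (localization A W)" by (rule category_localization)
    show "category B" by unfold_locales
  next
    fix X assume "X \<in> Obj (localization A W)"
    then show "on_Obj G X \<in> Obj B"
      and "on_Arr G (Id (localization A W) X) = Id B (on_Obj G X)"
      using on_Obj_Obj by (auto simp: Obj_localization G_Obj Id_localization G_Arr)
  next
    fix f X Y assume "f \<in> Hom (localization A W) X Y"
    then show "on_Arr G f \<in> Hom B (on_Obj G X) (on_Obj G Y)"
      using zigzag_eval_Hom by (auto simp: Hom_localization G_Arr G_Obj)
  next
    fix f g X Y Z assume "f \<in> Hom (localization A W) X Y" "g \<in> Hom (localization A W) Y Z"
    then show "on_Arr G (g \<cdot>\<^bsub>localization A W\<^esub> f) = on_Arr G g \<cdot>\<^bsub>B\<^esub> on_Arr G f"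
      by (auto simp: Hom_localization Comp_localization G_Arr zigzag_append zigzag_eval_append)
  qed
  moreover have "on_Arr G (on_Arr (localization_functor A W) f) = on_Arr F f" if "f \<in> Arr A" for f
  proof -
    have f: "f \<in> Hom A (Dom A f) (Cod A f)" using that by (simp add: Hom_def)
    show ?thesis
      using B.Id_Comp[OF on_Arr_Hom[OF f]]
      by (simp add: on_Arr_localization_functor[OF f] G_Arr[OF zigzag_Fwd[OF f]])
  qed
  ultimately show ?thesis
    by (intro exI[of _ G]) (auto simp: comp_functor_def G_Obj, simp add: localization_functor_def)
qed

end

theorem (in localizing) localization_unique:
  assumes G: "is_functor (localization A W) B G" and H: "is_functor (localization A W) B H"
    and Obj: "\<And>X. X \<in> Obj A \<Longrightarrow> on_Obj (comp_functor G (localization_functor A W)) X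
      = on_Obj (comp_functor H (localization_functor A W)) X"
    and Arr: "\<And>f. f \<in> Arr A \<Longrightarrow> on_Arr (comp_functor G (localization_functor A W)) f
      = on_Arr (comp_functor H (localization_functor A W)) f"
  shows "X \<in> Obj (localization A W) \<Longrightarrow> on_Obj G X = on_Obj H X"
    and "a \<in> Arr (localization A W) \<Longrightarrow> on_Arr G a = on_Arr H a"
proof -
  interpret L: category "localization A W" by (rule category_localization)
  interpret G: is_functor "localization A W" B G by (rule G)
  interpret H: is_functor "localization A W" B H by (rule H)
  show ObjL: "on_Obj G X = on_Obj H X" if "X \<in> Obj (localization A W)" for X
    using Obj[of X] that by (simp add: Obj_localization comp_functor_def localization_functor_def)
  have inverse: "inverse_pair B (on_Arr K u) (on_Arr K v)"
    if K: "is_functor (localization A W) B K" and uv: "inverse_pair (localization A W) u v" for K u v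
  proof -
    interpret K: is_functor "localization A W" B K by (rule K)
    have u: "u \<in> Hom (localization A W) (Dom (localization A W) u) (Cod (localization A W) u)"
      and v: "v \<in> Hom (localization A W) (Cod (localization A W) u) (Dom (localization A W) u)"
      using uv by (auto simp: inverse_pair_def Hom_def)
    have "Dom (localization A W) u \<in> Obj (localization A W)"
      "Cod (localization A W) u \<in> Obj (localization A W)"
      using u L.Dom_Obj L.Cod_Obj by (auto simp: Hom_def)
    then show ?thesis
      using K.on_Arr_Hom[OF u] K.on_Arr_Hom[OF v] K.on_Arr_Comp[OF u v] K.on_Arr_Comp[OF v u]
        K.on_Arr_Id uv
      by (auto simp: inverse_pair_def Hom_def)
  qed
  have fwd: "on_Arr G (zigzag_class A W X Y [Fwd f]) = on_Arr H (zigzag_class A W X Y [Fwd f])"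
    if "f \<in> Hom A X Y" for f X Y
    using Arr[of f] that on_Arr_localization_functor[OF that]
    by (simp add: comp_functor_def Hom_def)
  have bwd: "on_Arr G (zigzag_class A W (Cod A w) (Dom A w) [Bwd w])
      = on_Arr H (zigzag_class A W (Cod A w) (Dom A w) [Bwd w])" if w: "w \<in> W" for w
  proof -
    have "on_Arr G (on_Arr (localization_functor A W) w)
        = on_Arr H (on_Arr (localization_functor A W) w)"
      using Arr[of w] w W_Arr by (auto simp: comp_functor_def)
    then show ?thesis
      using inverse[OF G localization_inverse_pair[OF w]]
        inverse[OF H localization_inverse_pair[OF w]] G.B.inverse_pair_unique by metis
  qed
  have step: "on_Arr G (zigzag_class A W X Z (p @ q)) = on_Arr H (zigzag_class A W X Z (p @ q))"
    if pq: "zigzag A W X p Y" "zigzag A W Y q Z"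
      and "on_Arr G (zigzag_class A W X Y p) = on_Arr H (zigzag_class A W X Y p)"
      and "on_Arr G (zigzag_class A W Y Z q) = on_Arr H (zigzag_class A W Y Z q)" for X Y Z p q
  proof -
    have "zigzag_class A W X Y p \<in> Hom (localization A W) X Y"
      "zigzag_class A W Y Z q \<in> Hom (localization A W) Y Z"
      using pq by (auto simp: Hom_localization)
    then show ?thesis
      using that G.on_Arr_Comp H.on_Arr_Comp Comp_localization[OF pq] by metis
  qed
  have "on_Arr G (zigzag_class A W X Y p) = on_Arr H (zigzag_class A W X Y p)"
    if "zigzag A W X p Y" for X Y p
    using that
  proof (induction p arbitrary: X)
    case Nil
    then have "X = Y" "X \<in> Obj (localization A W)" by (auto simp: Obj_localization)
    then show ?case using G.on_Arr_Id H.on_Arr_Id ObjL by (simp add: Id_localization)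
  next
    case (Cons s p)
    show ?case
    proof (cases s)
      case (Fwd f)
      then have f: "f \<in> Hom A X (Cod A f)" using Cons.prems by (simp add: Hom_def)
      have "zigzag A W (Cod A f) p Y" using Cons.prems Fwd by simp
      then show ?thesis
        using step[OF zigzag_Fwd[OF f] _ fwd[OF f]] Cons.IH Fwd by simp
    next
      case (Bwd w)
      then have w: "w \<in> W" "X = Cod A w" and p: "zigzag A W (Dom A w) p Y"
        using Cons.prems by simp_all
      then show ?thesis
        using step[OF zigzag_Bwd[OF w(1)] p bwd[OF w(1)]] Cons.IH Bwd by simp
    qed
  qed
  then show "on_Arr G a = on_Arr H a" if "a \<in> Arr (localization A W)"
    using that by (auto simp: localization_def)
qed


section \<open>Model structures\<close>

definition two_out_of_three :: "('o, 'm) cat \<Rightarrow> 'm set \<Rightarrow> bool" where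
  "two_out_of_three A S \<longleftrightarrow> (\<forall>f \<in> Arr A. \<forall>g \<in> Arr A. Cod A f = Dom A g \<longrightarrow>
     (f \<in> S \<and> g \<in> S \<longrightarrow> g \<cdot>\<^bsub>A\<^esub> f \<in> S) \<and>
     (f \<in> S \<and> g \<cdot>\<^bsub>A\<^esub> f \<in> S \<longrightarrow> g \<in> S) \<and>
     (g \<in> S \<and> g \<cdot>\<^bsub>A\<^esub> f \<in> S \<longrightarrow> f \<in> S))"

definition retract_of :: "('o, 'm) cat \<Rightarrow> 'm \<Rightarrow> 'm \<Rightarrow> bool" where
  "retract_of A f g \<longleftrightarrow> f \<in> Arr A \<and> g \<in> Arr A \<and>
     (\<exists>s \<in> Hom A (Dom A f) (Dom A g). \<exists>r \<in> Hom A (Dom A g) (Dom A f).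
      \<exists>s' \<in> Hom A (Cod A f) (Cod A g). \<exists>r' \<in> Hom A (Cod A g) (Cod A f).
        r \<cdot>\<^bsub>A\<^esub> s = Id A (Dom A f) \<and> r' \<cdot>\<^bsub>A\<^esub> s' = Id A (Cod A f) \<and>
        g \<cdot>\<^bsub>A\<^esub> s = s' \<cdot>\<^bsub>A\<^esub> f \<and> f \<cdot>\<^bsub>A\<^esub> r = r' \<cdot>\<^bsub>A\<^esub> g)"

definition retract_closed :: "('o, 'm) cat \<Rightarrow> 'm set \<Rightarrow> bool" where
  "retract_closed A S \<longleftrightarrow> (\<forall>f g. retract_of A f g \<and> g \<in> S \<longrightarrow> f \<in> S)"

definition lifting_square :: "('o, 'm) cat \<Rightarrow> 'm \<Rightarrow> 'm \<Rightarrow> 'm \<Rightarrow> 'm \<Rightarrow> bool" where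
  "lifting_square A i p a b \<longleftrightarrow> i \<in> Arr A \<and> p \<in> Arr A \<and>
     a \<in> Hom A (Dom A i) (Dom A p) \<and> b \<in> Hom A (Cod A i) (Cod A p) \<and> p \<cdot>\<^bsub>A\<^esub> a = b \<cdot>\<^bsub>A\<^esub> i"

definition is_lifting :: "('o, 'm) cat \<Rightarrow> 'm \<Rightarrow> 'm \<Rightarrow> 'm \<Rightarrow> 'm \<Rightarrow> 'm \<Rightarrow> bool" where
  "is_lifting A i p a b s \<longleftrightarrow>
     s \<in> Hom A (Cod A i) (Dom A p) \<and> s \<cdot>\<^bsub>A\<^esub> i = a \<and> p \<cdot>\<^bsub>A\<^esub> s = b"

locale model_structure = category A for A :: "('o, 'm) cat" +
  fixes CoFib Fib Weq :: "'m set"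
  assumes CoFib_Arr: "CoFib \<subseteq> Arr A" and Fib_Arr: "Fib \<subseteq> Arr A" and Weq_Arr: "Weq \<subseteq> Arr A"
    and CM1: "two_out_of_three A Weq"
    and CM2: "retract_closed A CoFib" "retract_closed A Fib" "retract_closed A Weq"
    and CM3: "(i \<in> CoFib \<inter> Weq \<and> p \<in> Fib) \<or> (i \<in> CoFib \<and> p \<in> Fib \<inter> Weq) \<Longrightarrow>
      lifting_square A i p a b \<Longrightarrow> \<exists>s. is_lifting A i p a b s"
    and CM4: "f \<in> Arr A \<Longrightarrow> \<exists>i \<in> CoFib \<inter> Weq. \<exists>p \<in> Fib. Cod A i = Dom A p \<and> p \<cdot>\<^bsub>A\<^esub> i = f"
      "f \<in> Arr A \<Longrightarrow> \<exists>j \<in> CoFib. \<exists>q \<in> Fib \<inter> Weq. Cod A j = Dom A q \<and> q \<cdot>\<^bsub>A\<^esub> j = f"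

locale orthogonal_model_structure = model_structure +
  assumes lifting_unique: "(i \<in> CoFib \<inter> Weq \<and> p \<in> Fib) \<or> (i \<in> CoFib \<and> p \<in> Fib \<inter> Weq) \<Longrightarrow>
      lifting_square A i p a b \<Longrightarrow> is_lifting A i p a b s \<Longrightarrow> is_lifting A i p a b t \<Longrightarrow> s = t"

definition cofibrant_objects :: "('o, 'm) cat \<Rightarrow> 'm set \<Rightarrow> 'm set \<Rightarrow> 'o set" where
  "cofibrant_objects A Fib Weq = {C \<in> Obj A. \<forall>p \<in> Fib \<inter> Weq. \<forall>u \<in> Hom A C (Cod A p).
     \<exists>!v. v \<in> Hom A C (Dom A p) \<and> p \<cdot>\<^bsub>A\<^esub> v = u}"

definition fibrant_objects :: "('o, 'm) cat \<Rightarrow> 'm set \<Rightarrow> 'm set \<Rightarrow> 'o set" where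
  "fibrant_objects A CoFib Weq = {F \<in> Obj A. \<forall>i \<in> CoFib \<inter> Weq. \<forall>u \<in> Hom A (Dom A i) F.
     \<exists>!v. v \<in> Hom A (Cod A i) F \<and> v \<cdot>\<^bsub>A\<^esub> i = u}"

definition enough_cofibrant_objects :: "('o, 'm) cat \<Rightarrow> 'm set \<Rightarrow> 'm set \<Rightarrow> bool" where
  "enough_cofibrant_objects A Fib Weq \<longleftrightarrow>
     (\<forall>X \<in> Obj A. \<exists>C \<in> cofibrant_objects A Fib Weq. \<exists>p \<in> Fib \<inter> Weq. p \<in> Hom A C X)"

definition enough_fibrant_objects :: "('o, 'm) cat \<Rightarrow> 'm set \<Rightarrow> 'm set \<Rightarrow> bool" where
  "enough_fibrant_objects A CoFib Weq \<longleftrightarrow>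
     (\<forall>X \<in> Obj A. \<exists>F \<in> fibrant_objects A CoFib Weq. \<exists>i \<in> CoFib \<inter> Weq. i \<in> Hom A X F)"

definition Ho :: "('o, 'm) cat \<Rightarrow> 'm set \<Rightarrow> ('o, 'o \<times> 'm step list set \<times> 'o) cat" where
  "Ho A Weq = localization A Weq"

end

theory Submission
  imports Defs
begin

text \<open>Every weak equivalence between bifibrant objects is an isomorphism: it factors as a trivial
  cofibration \<open>i\<close> followed by a trivial fibration \<open>p\<close>, and the two solutions of the
  lifting problem of \<open>i\<close> against \<open>p\<close> given by the identity and by the retraction of
  \<open>i\<close> (respectively, the section of \<open>p\<close>) have to agree. For each object \<open>X\<close> choose a
  trivial fibration \<open>q X : Q X \<rightarrow> X\<close> with \<open>Q X\<close> cofibrant and a trivial cofibration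
  \<open>r X : Q X \<rightarrow> R X\<close> with \<open>R X\<close> fibrant. Then \<open>R X\<close> is bifibrant and, by unique
  lifting, functorial in \<open>X\<close>; the functor inverts weak equivalences, so it descends to the
  homotopy category, and the spans \<open>X \<leftarrow> Q X \<rightarrow> R X\<close> provide unit and counit.\<close>

section \<open>Categories and functors\<close>

lemma (in category) Hom_Obj: "f \<in> Hom C X Y \<Longrightarrow> X \<in> Obj C \<and> Y \<in> Obj C"
  using Dom_Obj Cod_Obj by (auto simp: Hom_def)

section \<open>Inverse pairs: cancellation, composition and transport along functors\<close>

lemma inverse_pair_sym:
  assumes "inverse_pair C f g"
  shows "inverse_pair C g f"
  using assms by (auto simp: inverse_pair_def Hom_def)

lemma inverse_pair_Hom_iff:
  assumes "f \<in> Hom C X Y"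
  shows "inverse_pair C f g \<longleftrightarrow>
    g \<in> Hom C Y X \<and> g \<cdot>\<^bsub>C\<^esub> f = Id C X \<and> f \<cdot>\<^bsub>C\<^esub> g = Id C Y"
  using assms by (auto simp: inverse_pair_def Hom_def)

lemma (in category) cancel_inverse_left:
  assumes f: "f \<in> Hom C X Y" and g: "inverse_pair C f g" and a: "a \<in> Hom C W X"
  shows "g \<cdot> (f \<cdot> a) = a"
proof -
  have gH: "g \<in> Hom C Y X" and gf: "g \<cdot> f = Id C X"
    using g inverse_pair_Hom_iff[OF f] by auto
  show ?thesis using Comp_assoc[OF a f gH] Id_Comp[OF a] by (simp add: gf)
qed

lemma (in category) cancel_inverse_right:
  assumes f: "f \<in> Hom C X Y" and g: "inverse_pair C f g" and a: "a \<in> Hom C Y Z"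
  shows "(a \<cdot> f) \<cdot> g = a"
proof -
  have gH: "g \<in> Hom C Y X" and fg: "f \<cdot> g = Id C Y"
    using g inverse_pair_Hom_iff[OF f] by auto
  show ?thesis using Comp_assoc[OF gH f a] Comp_Id[OF a] by (simp add: fg)
qed

lemma (in category) inverse_pair_comp:
  assumes f: "f \<in> Hom C X Y" and g: "g \<in> Hom C Y Z"
    and f': "inverse_pair C f f'" and g': "inverse_pair C g g'"
  shows "inverse_pair C (g \<cdot> f) (f' \<cdot> g')"
proof -
  have f'H: "f' \<in> Hom C Y X" and f'f: "f' \<cdot> f = Id C X"
    using f' inverse_pair_Hom_iff[OF f] by auto
  have g'H: "g' \<in> Hom C Z Y" and gg': "g \<cdot> g' = Id C Z"
    using g' inverse_pair_Hom_iff[OF g] by auto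
  have "(f' \<cdot> g') \<cdot> (g \<cdot> f) = Id C X"
    using Comp_assoc[OF Comp_Hom[OF f g] g'H f'H] cancel_inverse_left[OF g g' f] f'f by simp
  moreover have "(g \<cdot> f) \<cdot> (f' \<cdot> g') = Id C Z"
    using Comp_assoc[OF g'H f'H Comp_Hom[OF f g]] cancel_inverse_right[OF f f' g] gg' by simp
  ultimately show ?thesis
    using inverse_pair_Hom_iff[OF Comp_Hom[OF f g]] Comp_Hom[OF g'H f'H] by blast
qed

lemma (in is_functor) preserves_inverse_pair:
  assumes "inverse_pair A u v"
  shows "inverse_pair B (on_Arr F u) (on_Arr F v)"
proof -
  have u: "u \<in> Hom A (Dom A u) (Cod A u)" and v: "v \<in> Hom A (Cod A u) (Dom A u)"
    using assms by (auto simp: inverse_pair_def Hom_def)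
  have "Dom A u \<in> Obj A" "Cod A u \<in> Obj A" using A.Hom_Obj[OF u] by auto
  then show ?thesis
    using on_Arr_Hom[OF v] on_Arr_Comp[OF u v] on_Arr_Comp[OF v u] on_Arr_Id assms
    unfolding inverse_pair_Hom_iff[OF on_Arr_Hom[OF u]] by (simp add: inverse_pair_def)
qed

section \<open>Full subcategories, composite functors, and naturality over a localization\<close>

lemma Hom_full_subcategory:
  "Hom (full_subcategory C S) X Y = (if X \<in> S \<and> Y \<in> S then Hom C X Y else {})"
  by (auto simp: Hom_def full_subcategory_def)

lemma full_subcategory_simps:
  "Obj (full_subcategory C S) = Obj C \<inter> S"
  "Id (full_subcategory C S) = Id C"
  "Comp (full_subcategory C S) = Comp C"
  by (simp_all add: full_subcategory_def)

lemma (in category) category_full_subcategory: "category (full_subcategory C S)"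
proof
  fix f assume "f \<in> Arr (full_subcategory C S)"
  then show "Dom (full_subcategory C S) f \<in> Obj (full_subcategory C S)"
    and "Cod (full_subcategory C S) f \<in> Obj (full_subcategory C S)"
    using Dom_Obj Cod_Obj by (auto simp: full_subcategory_def)
qed (auto simp: Hom_full_subcategory full_subcategory_simps split: if_splits
    intro: Id_Hom Comp_Hom Comp_Id Id_Comp Comp_assoc)

text \<open>An inverse of \<open>f\<close> runs between the same two objects of \<open>S\<close>, so
  fullness puts it into the subcategory.\<close>

lemma is_iso_full_subcategory:
  assumes "f \<in> Hom C X Y" "X \<in> S" "Y \<in> S" "is_iso C f"
  shows "is_iso (full_subcategory C S) f"
proof -
  have f: "f \<in> Hom (full_subcategory C S) X Y" using assms by (simp add: Hom_full_subcategory)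
  show ?thesis
    using assms unfolding is_iso_def inverse_pair_Hom_iff[OF f] inverse_pair_Hom_iff[OF assms(1)]
    by (simp add: Hom_full_subcategory full_subcategory_simps)
qed

lemma (in is_functor) is_functor_full_subcategory: "is_functor (full_subcategory A S) B F"
  by (intro is_functor.intro is_functor_axioms.intro A.category_full_subcategory B.category_axioms)
    (auto simp: Hom_full_subcategory full_subcategory_simps on_Obj_Obj on_Arr_Id
      split: if_splits intro: on_Arr_Hom on_Arr_Comp)

lemma (in category) is_functor_id: "is_functor C C id_functor"
  by (intro is_functor.intro is_functor_axioms.intro category_axioms) (auto simp: id_functor_def)

lemma is_functor_comp:
  assumes "is_functor A B F" "is_functor B C G"
  shows "is_functor A C (comp_functor G F)"
proof -
  interpret F: is_functor A B F by fact
  interpret G: is_functor B C G by fact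
  show ?thesis
  proof (intro is_functor.intro is_functor_axioms.intro F.A.category_axioms G.B.category_axioms)
    fix f g X Y Z assume "f \<in> Hom A X Y" "g \<in> Hom A Y Z"
    then show "on_Arr (comp_functor G F) (g \<cdot>\<^bsub>A\<^esub> f)
        = on_Arr (comp_functor G F) g \<cdot>\<^bsub>C\<^esub> on_Arr (comp_functor G F) f"
      using F.on_Arr_Comp G.on_Arr_Comp[OF F.on_Arr_Hom F.on_Arr_Hom] by (simp add: comp_functor_def)
  qed (auto simp: comp_functor_def F.on_Obj_Obj G.on_Obj_Obj F.on_Arr_Id G.on_Arr_Id
      intro: F.on_Arr_Hom G.on_Arr_Hom)
qed

text \<open>Every arrow of the localization is a composite of images of arrows of \<open>A\<close>
  and of inverses of images of \<open>W\<close>. Naturality squares can be pasted and can be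
  inverted along isomorphisms, so those at arrows of \<open>A\<close> give all the others. This is
  what the counit of the equivalence requires.\<close>

lemma (in localizing) localization_naturality:
  assumes G: "is_functor (localization A W) B G" and H: "is_functor (localization A W) B H"
    and \<tau>: "\<And>X. X \<in> Obj A \<Longrightarrow> \<tau> X \<in> Hom B (on_Obj G X) (on_Obj H X)"
    and nat: "\<And>f X Y. f \<in> Hom A X Y \<Longrightarrow>
      \<tau> Y \<cdot>\<^bsub>B\<^esub> on_Arr G (on_Arr (localization_functor A W) f)
        = on_Arr H (on_Arr (localization_functor A W) f) \<cdot>\<^bsub>B\<^esub> \<tau> X"
    and a: "a \<in> Hom (localization A W) X Y"
  shows "\<tau> Y \<cdot>\<^bsub>B\<^esub> on_Arr G a = on_Arr H a \<cdot>\<^bsub>B\<^esub> \<tau> X"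
proof -
  let ?L = "localization A W"
  interpret L: category ?L by (rule category_localization)
  interpret G: is_functor ?L B G by (rule G)
  interpret H: is_functor ?L B H by (rule H)
  \<comment> \<open>Pasting of squares, used to split the first step off a zigzag.\<close>
  have comp: "\<tau> Z \<cdot>\<^bsub>B\<^esub> on_Arr G (v \<cdot>\<^bsub>?L\<^esub> u) = on_Arr H (v \<cdot>\<^bsub>?L\<^esub> u) \<cdot>\<^bsub>B\<^esub> \<tau> X"
    if u: "u \<in> Hom ?L X Y" and v: "v \<in> Hom ?L Y Z"
      and nu: "\<tau> Y \<cdot>\<^bsub>B\<^esub> on_Arr G u = on_Arr H u \<cdot>\<^bsub>B\<^esub> \<tau> X"
      and nv: "\<tau> Z \<cdot>\<^bsub>B\<^esub> on_Arr G v = on_Arr H v \<cdot>\<^bsub>B\<^esub> \<tau> Y" for u v X Y Z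
  proof -
    have X: "\<tau> X \<in> Hom B (on_Obj G X) (on_Obj H X)" and Y: "\<tau> Y \<in> Hom B (on_Obj G Y) (on_Obj H Y)"
      and Z: "\<tau> Z \<in> Hom B (on_Obj G Z) (on_Obj H Z)"
      using L.Hom_Obj[OF u] L.Hom_Obj[OF v] \<tau> by (auto simp: Obj_localization)
    note Gu = G.on_Arr_Hom[OF u] and Gv = G.on_Arr_Hom[OF v]
    note Hu = H.on_Arr_Hom[OF u] and Hv = H.on_Arr_Hom[OF v]
    show ?thesis
      using G.B.Comp_assoc[OF Gu Gv Z] G.B.Comp_assoc[OF Gu Y Hv] G.B.Comp_assoc[OF X Hu Hv]
      by (simp add: G.on_Arr_Comp[OF u v] H.on_Arr_Comp[OF u v] nu nv)
  qed
  \<comment> \<open>Inverting a square: insert \<open>on_Arr H v\<close> composed with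
    \<open>on_Arr H u\<close>, apply the square at \<open>u\<close>, then cancel
    \<open>on_Arr G u\<close> against \<open>on_Arr G v\<close>.\<close>
  have bwd: "\<tau> X \<cdot>\<^bsub>B\<^esub> on_Arr G v = on_Arr H v \<cdot>\<^bsub>B\<^esub> \<tau> Y"
    if u: "u \<in> Hom ?L X Y" and uv: "inverse_pair ?L u v"
      and nu: "\<tau> Y \<cdot>\<^bsub>B\<^esub> on_Arr G u = on_Arr H u \<cdot>\<^bsub>B\<^esub> \<tau> X" for u v X Y
  proof -
    have X: "\<tau> X \<in> Hom B (on_Obj G X) (on_Obj H X)" and Y: "\<tau> Y \<in> Hom B (on_Obj G Y) (on_Obj H Y)"
      using L.Hom_Obj[OF u] \<tau> by (auto simp: Obj_localization)
    have v: "v \<in> Hom ?L Y X" using uv inverse_pair_Hom_iff[OF u] by blast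
    note Gu = G.on_Arr_Hom[OF u] and Gv = G.on_Arr_Hom[OF v]
    note Hu = H.on_Arr_Hom[OF u] and Hv = H.on_Arr_Hom[OF v]
    have "\<tau> X \<cdot>\<^bsub>B\<^esub> on_Arr G v
        = on_Arr H v \<cdot>\<^bsub>B\<^esub> (on_Arr H u \<cdot>\<^bsub>B\<^esub> (\<tau> X \<cdot>\<^bsub>B\<^esub> on_Arr G v))"
      using G.B.cancel_inverse_left[OF Hu H.preserves_inverse_pair[OF uv]
          G.B.Comp_Hom[OF Gv X]] by simp
    also have "\<dots> = on_Arr H v \<cdot>\<^bsub>B\<^esub> ((\<tau> Y \<cdot>\<^bsub>B\<^esub> on_Arr G u) \<cdot>\<^bsub>B\<^esub> on_Arr G v)"
      using G.B.Comp_assoc[OF Gv X Hu] nu by simp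
    also have "\<dots> = on_Arr H v \<cdot>\<^bsub>B\<^esub> \<tau> Y"
      using G.B.cancel_inverse_right[OF Gu G.preserves_inverse_pair[OF uv] Y] by simp
    finally show ?thesis .
  qed
  have "\<tau> Y \<cdot>\<^bsub>B\<^esub> on_Arr G (zigzag_class A W X Y p)
      = on_Arr H (zigzag_class A W X Y p) \<cdot>\<^bsub>B\<^esub> \<tau> X" if "zigzag A W X p Y" for X p
    using that
  proof (induction p arbitrary: X)
    case Nil
    then have "X = Y" "X \<in> Obj A" by auto
    then show ?case
      using G.on_Arr_Id[of X] H.on_Arr_Id[of X] G.B.Comp_Id[OF \<tau>] G.B.Id_Comp[OF \<tau>]
      by (simp add: Id_localization Obj_localization)
  next
    case (Cons s p)
    show ?case
    proof (cases s)
      case (Fwd f)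
      then have f: "f \<in> Hom A X (Cod A f)" and p: "zigzag A W (Cod A f) p Y"
        using Cons.prems by (simp_all add: Hom_def)
      have u: "zigzag_class A W X (Cod A f) [Fwd f] \<in> Hom ?L X (Cod A f)"
        and v: "zigzag_class A W (Cod A f) Y p \<in> Hom ?L (Cod A f) Y"
        using zigzag_Fwd[OF f] p by (auto simp: Hom_localization)
      show ?thesis
        using comp[OF u v] nat[OF f] Cons.IH[OF p] Fwd
        by (simp add: Comp_localization[OF zigzag_Fwd[OF f] p] on_Arr_localization_functor[OF f])
    next
      case (Bwd w)
      then have w: "w \<in> W" and X: "X = Cod A w" and p: "zigzag A W (Dom A w) p Y"
        using Cons.prems by simp_all
      have wH: "w \<in> Hom A (Dom A w) (Cod A w)" using w W_Arr by (auto simp: Hom_def)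
      \<comment> \<open>The square at the image of \<open>w\<close> comes from \<open>nat\<close>;
        \<open>bwd\<close> turns it into the square at the formal inverse
        \<open>[Bwd w]\<close>.\<close>
      have w': "on_Arr (localization_functor A W) w \<in> Hom ?L (Dom A w) (Cod A w)"
        using zigzag_Fwd[OF wH] by (auto simp: on_Arr_localization_functor[OF wH] Hom_localization)
      have u: "zigzag_class A W X (Dom A w) [Bwd w] \<in> Hom ?L X (Dom A w)"
        and v: "zigzag_class A W (Dom A w) Y p \<in> Hom ?L (Dom A w) Y"
        using zigzag_Bwd[OF w] p X by (auto simp: Hom_localization)
      show ?thesis
        using comp[OF u v] bwd[OF w' localization_inverse_pair[OF w] nat[OF wH]] Cons.IH[OF p] Bwd X
        by (simp add: Comp_localization[OF zigzag_Bwd[OF w] p])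
    qed
  qed
  then show ?thesis using a by (auto simp: Hom_localization)
qed

section \<open>Weak equivalences between bifibrant objects\<close>

context model_structure
begin

lemma Weq_comp: "f \<in> Hom A X Y \<Longrightarrow> g \<in> Hom A Y Z \<Longrightarrow> f \<in> Weq \<Longrightarrow> g \<in> Weq \<Longrightarrow> g \<cdot>\<^bsub>A\<^esub> f \<in> Weq"
  and Weq_cancel_right: "f \<in> Hom A X Y \<Longrightarrow> g \<in> Hom A Y Z \<Longrightarrow> f \<in> Weq \<Longrightarrow> g \<cdot>\<^bsub>A\<^esub> f \<in> Weq \<Longrightarrow> g \<in> Weq"
  and Weq_cancel_left: "f \<in> Hom A X Y \<Longrightarrow> g \<in> Hom A Y Z \<Longrightarrow> g \<in> Weq \<Longrightarrow> g \<cdot>\<^bsub>A\<^esub> f \<in> Weq \<Longrightarrow> f \<in> Weq"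
  using CM1 by (auto simp: two_out_of_three_def Hom_def)

lemma factor_TCoFib_Fib:
  assumes f: "f \<in> Hom A X Y"
  obtains i p Z where "i \<in> Hom A X Z" "p \<in> Hom A Z Y" "i \<in> CoFib \<inter> Weq" "p \<in> Fib" "p \<cdot>\<^bsub>A\<^esub> i = f"
proof -
  obtain i p where ip: "i \<in> CoFib \<inter> Weq" "p \<in> Fib" "Cod A i = Dom A p" "p \<cdot>\<^bsub>A\<^esub> i = f"
    using CM4(1)[of f] f unfolding Hom_def by blast
  then have i: "i \<in> Hom A (Dom A i) (Dom A p)" and p: "p \<in> Hom A (Dom A p) (Cod A p)"
    using CoFib_Arr Fib_Arr by (auto simp: Hom_def)
  \<comment> \<open>The factorization axiom only matches the middle object; the outer ends are read
    off from the composite being \<open>f\<close>.\<close>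
  have "Dom A i = X" "Cod A p = Y" using Comp_Hom[OF i p] ip(4) f by (auto simp: Hom_def)
  then show ?thesis using that i p ip by blast
qed

text \<open>The factorization axiom supplies some weak equivalence \<open>i\<close> out of
  \<open>X\<close>; cancelling \<open>i\<close> from the equation that \<open>i\<close> after
  \<open>Id A X\<close> is \<open>i\<close>, by two-out-of-three, leaves the identity.\<close>

lemma Weq_Id:
  assumes "X \<in> Obj A"
  shows "Id A X \<in> Weq"
proof -
  obtain i Z where "i \<in> Hom A X Z" "i \<in> Weq" using factor_TCoFib_Fib[OF Id_Hom[OF assms]] by blast
  then show ?thesis using Weq_cancel_left[OF Id_Hom[OF assms]] Comp_Id by auto
qed

lemma cofibrant_ex1:
  assumes "C \<in> cofibrant_objects A Fib Weq" "p \<in> Fib \<inter> Weq" "p \<in> Hom A X Y" "u \<in> Hom A C Y"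
  shows "\<exists>!v. v \<in> Hom A C X \<and> p \<cdot>\<^bsub>A\<^esub> v = u"
proof -
  have "X = Dom A p" "Y = Cod A p" using assms(3) by (auto simp: Hom_def)
  then show ?thesis using assms unfolding cofibrant_objects_def by blast
qed

lemma cofibrant_lift:
  assumes "C \<in> cofibrant_objects A Fib Weq" "p \<in> Fib \<inter> Weq" "p \<in> Hom A X Y" "u \<in> Hom A C Y"
  obtains v where "v \<in> Hom A C X" "p \<cdot>\<^bsub>A\<^esub> v = u"
  using cofibrant_ex1[OF assms] by blast

text \<open>The uniqueness half of cofibrancy, applied to the common composite. With its dual
  \<open>fibrant_cancel\<close> it serves to compare two lifts or two extensions.\<close>

lemma cofibrant_cancel:
  assumes C: "C \<in> cofibrant_objects A Fib Weq" and p: "p \<in> Fib \<inter> Weq" "p \<in> Hom A X Y"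
    and v: "v \<in> Hom A C X" "v' \<in> Hom A C X" "p \<cdot>\<^bsub>A\<^esub> v = p \<cdot>\<^bsub>A\<^esub> v'"
  shows "v = v'"
  using cofibrant_ex1[OF C p Comp_Hom[OF v(1) p(2)]] v by metis

lemma fibrant_ex1:
  assumes "F \<in> fibrant_objects A CoFib Weq" "i \<in> CoFib \<inter> Weq" "i \<in> Hom A X Y" "u \<in> Hom A X F"
  shows "\<exists>!v. v \<in> Hom A Y F \<and> v \<cdot>\<^bsub>A\<^esub> i = u"
proof -
  have "X = Dom A i" "Y = Cod A i" using assms(3) by (auto simp: Hom_def)
  then show ?thesis using assms unfolding fibrant_objects_def by blast
qed

lemma fibrant_lift:
  assumes "F \<in> fibrant_objects A CoFib Weq" "i \<in> CoFib \<inter> Weq" "i \<in> Hom A X Y" "u \<in> Hom A X F"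
  obtains v where "v \<in> Hom A Y F" "v \<cdot>\<^bsub>A\<^esub> i = u"
  using fibrant_ex1[OF assms] by blast

lemma fibrant_cancel:
  assumes F: "F \<in> fibrant_objects A CoFib Weq" and i: "i \<in> CoFib \<inter> Weq" "i \<in> Hom A X Y"
    and v: "v \<in> Hom A Y F" "v' \<in> Hom A Y F" "v \<cdot>\<^bsub>A\<^esub> i = v' \<cdot>\<^bsub>A\<^esub> i"
  shows "v = v'"
  using fibrant_ex1[OF F i Comp_Hom[OF i(2) v(1)]] v by metis

end

section \<open>Unique lifting and its consequences for bifibrant objects\<close>

context orthogonal_model_structure
begin

abbreviation "bifibrant \<equiv> cofibrant_objects A Fib Weq \<inter> fibrant_objects A CoFib Weq"

text \<open>Both arrows solve the lifting problem whose top is \<open>s\<close> after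
  \<open>i\<close> and whose bottom is \<open>p\<close> after \<open>s\<close>. In this form
  uniqueness needs no square to be given in advance.\<close>

lemma lifts_eq:
  assumes ip: "(i \<in> CoFib \<inter> Weq \<and> p \<in> Fib) \<or> (i \<in> CoFib \<and> p \<in> Fib \<inter> Weq)"
    and i: "i \<in> Hom A X Y" and p: "p \<in> Hom A E B"
    and s: "s \<in> Hom A Y E" and t: "t \<in> Hom A Y E"
    and eq: "s \<cdot>\<^bsub>A\<^esub> i = t \<cdot>\<^bsub>A\<^esub> i" "p \<cdot>\<^bsub>A\<^esub> s = p \<cdot>\<^bsub>A\<^esub> t"
  shows "s = t"
proof (rule lifting_unique[OF ip])
  show "lifting_square A i p (s \<cdot>\<^bsub>A\<^esub> i) (p \<cdot>\<^bsub>A\<^esub> s)"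
    using i p Comp_Hom[OF i s] Comp_Hom[OF s p] Comp_assoc[OF i s p]
    by (auto simp: lifting_square_def Hom_def)
  show "is_lifting A i p (s \<cdot>\<^bsub>A\<^esub> i) (p \<cdot>\<^bsub>A\<^esub> s) s" "is_lifting A i p (s \<cdot>\<^bsub>A\<^esub> i) (p \<cdot>\<^bsub>A\<^esub> s) t"
    using i p s t eq by (auto simp: is_lifting_def Hom_def)
qed

text \<open>Cofibrancy of \<open>X\<close> lifts the restriction of \<open>u\<close> along
  \<open>i\<close>, and the lifting axiom for \<open>i\<close> against \<open>p\<close> extends that
  lift to \<open>Y\<close>. This is why a fibrant replacement of a cofibrant object is
  bifibrant.\<close>

lemma TCoFib_cofibrant:
  assumes i: "i \<in> CoFib \<inter> Weq" "i \<in> Hom A X Y" and X: "X \<in> cofibrant_objects A Fib Weq"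
  shows "Y \<in> cofibrant_objects A Fib Weq"
  unfolding cofibrant_objects_def
proof (intro CollectI conjI ballI)
  show "Y \<in> Obj A" using Hom_Obj[OF i(2)] by simp
next
  fix p u assume p: "p \<in> Fib \<inter> Weq" and u: "u \<in> Hom A Y (Cod A p)"
  have pH: "p \<in> Hom A (Dom A p) (Cod A p)" using p Fib_Arr by (auto simp: Hom_def)
  obtain a where a: "a \<in> Hom A X (Dom A p)" "p \<cdot>\<^bsub>A\<^esub> a = u \<cdot>\<^bsub>A\<^esub> i"
    using cofibrant_lift[OF X p pH Comp_Hom[OF i(2) u]] .
  have "lifting_square A i p a u" using i pH a u by (auto simp: lifting_square_def Hom_def)
  then obtain s where "is_lifting A i p a u s" using CM3 i p by blast
  then have s: "s \<in> Hom A Y (Dom A p)" "p \<cdot>\<^bsub>A\<^esub> s = u" using i by (auto simp: is_lifting_def Hom_def)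
  show "\<exists>!v. v \<in> Hom A Y (Dom A p) \<and> p \<cdot>\<^bsub>A\<^esub> v = u"
  proof (rule ex1I[of _ s])
    fix t assume t: "t \<in> Hom A Y (Dom A p) \<and> p \<cdot>\<^bsub>A\<^esub> t = u"
    then have tH: "t \<in> Hom A Y (Dom A p)" by simp
    \<comment> \<open>Both restrictions to \<open>X\<close> lift the restriction of \<open>u\<close>
      through \<open>p\<close>, so cofibrancy of \<open>X\<close> identifies them; unique lifting
      then identifies \<open>t\<close> and \<open>s\<close>.\<close>
    have "t \<cdot>\<^bsub>A\<^esub> i = s \<cdot>\<^bsub>A\<^esub> i"
      using cofibrant_cancel[OF X p pH Comp_Hom[OF i(2) tH] Comp_Hom[OF i(2) s(1)]]
        Comp_assoc[OF i(2) tH pH] Comp_assoc[OF i(2) s(1) pH] t s by simp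
    then show "t = s" using lifts_eq[OF _ i(2) pH tH s(1)] i p t s by simp
  qed (use s in simp)
qed

lemma Weq_bifibrant_iso:
  assumes f: "f \<in> Hom A X Y" "f \<in> Weq" and X: "X \<in> bifibrant" and Y: "Y \<in> bifibrant"
  shows "is_iso A f"
proof -
  obtain i p Z where i: "i \<in> Hom A X Z" "i \<in> CoFib \<inter> Weq" and p: "p \<in> Hom A Z Y" "p \<in> Fib"
    and pi: "p \<cdot>\<^bsub>A\<^esub> i = f" using factor_TCoFib_Fib[OF f(1)] by metis
  \<comment> \<open>Two-out-of-three makes \<open>p\<close> trivial, since \<open>f\<close> and
    \<open>i\<close> are weak equivalences.\<close>
  have pT: "p \<in> Fib \<inter> Weq" using Weq_cancel_right[OF i(1) p(1)] i p pi f by auto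
  have XO: "X \<in> Obj A" and YO: "Y \<in> Obj A" and ZO: "Z \<in> Obj A"
    using Hom_Obj[OF i(1)] Hom_Obj[OF p(1)] by auto
  \<comment> \<open>Fibrancy of \<open>X\<close> extends its identity along \<open>i\<close> to a
    retraction; dually, cofibrancy of \<open>Y\<close> lifts its identity through \<open>p\<close>
    to a section.\<close>
  obtain r where r: "r \<in> Hom A Z X" "r \<cdot>\<^bsub>A\<^esub> i = Id A X"
    using fibrant_lift[OF _ i(2,1) Id_Hom[OF XO]] X by auto
  obtain s where s: "s \<in> Hom A Y Z" "p \<cdot>\<^bsub>A\<^esub> s = Id A Y"
    using cofibrant_lift[OF _ pT p(1) Id_Hom[OF YO]] Y by auto
  have ir: "i \<cdot>\<^bsub>A\<^esub> r \<in> Hom A Z Z" and sp: "s \<cdot>\<^bsub>A\<^esub> p \<in> Hom A Z Z"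
    using Comp_Hom i p r s by auto
  have iri: "(i \<cdot>\<^bsub>A\<^esub> r) \<cdot>\<^bsub>A\<^esub> i = i"
    using Comp_assoc[OF i(1) r(1) i(1)] r(2) Comp_Id[OF i(1)] by simp
  have psp: "p \<cdot>\<^bsub>A\<^esub> (s \<cdot>\<^bsub>A\<^esub> p) = p"
    using Comp_assoc[OF p(1) s(1) p(1)] s(2) Id_Comp[OF p(1)] by simp
  \<comment> \<open>The other two halves of bifibrancy enter here: \<open>i\<close> can be cancelled
    because \<open>Y\<close> is fibrant, and below \<open>p\<close> can be cancelled because
    \<open>X\<close> is cofibrant.\<close>
  have "(p \<cdot>\<^bsub>A\<^esub> (i \<cdot>\<^bsub>A\<^esub> r)) \<cdot>\<^bsub>A\<^esub> i = p \<cdot>\<^bsub>A\<^esub> i"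
    using Comp_assoc[OF i(1) ir p(1)] iri by simp
  then have pir: "p \<cdot>\<^bsub>A\<^esub> (i \<cdot>\<^bsub>A\<^esub> r) = p"
    using fibrant_cancel[OF _ i(2,1) Comp_Hom[OF ir p(1)] p(1)] Y by blast
  have "p \<cdot>\<^bsub>A\<^esub> ((s \<cdot>\<^bsub>A\<^esub> p) \<cdot>\<^bsub>A\<^esub> i) = p \<cdot>\<^bsub>A\<^esub> i"
    using Comp_assoc[OF i(1) sp p(1)] psp by simp
  then have spi: "(s \<cdot>\<^bsub>A\<^esub> p) \<cdot>\<^bsub>A\<^esub> i = i"
    using cofibrant_cancel[OF _ pT p(1) Comp_Hom[OF i(1) sp] i(1)] X by blast
  \<comment> \<open>Each of the two endomorphisms of \<open>Z\<close> agrees with the identity after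
    precomposition with \<open>i\<close> and after postcomposition with \<open>p\<close>, so unique
    lifting applies.\<close>
  have "i \<cdot>\<^bsub>A\<^esub> r = Id A Z" "s \<cdot>\<^bsub>A\<^esub> p = Id A Z"
    using lifts_eq[OF _ i(1) p(1) ir Id_Hom[OF ZO]] lifts_eq[OF _ i(1) p(1) sp Id_Hom[OF ZO]]
      iri pir spi psp i p Comp_Id[OF p(1)] Id_Comp[OF i(1)] by auto
  then have "inverse_pair A i r" "inverse_pair A p s"
    using r s by (auto simp: inverse_pair_Hom_iff[OF i(1)] inverse_pair_Hom_iff[OF p(1)])
  then show ?thesis using inverse_pair_comp[OF i(1) p(1)] pi by (auto simp: is_iso_def)
qed

lemma localizing_Weq: "localizing A Weq"
  using Weq_Arr by unfold_locales

end

section \<open>The bifibrant replacement functor\<close>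

text \<open>A choice of replacements, with no compatibility imposed between different objects. The
  arrow \<open>r X\<close> starts at \<open>Q X\<close> rather than at \<open>X\<close>, so that
  \<open>R X\<close> inherits cofibrancy.\<close>

locale bifibrant_replacement = orthogonal_model_structure +
  fixes Q R and q r
  assumes Q: "X \<in> Obj A \<Longrightarrow> Q X \<in> cofibrant_objects A Fib Weq"
    and R: "X \<in> Obj A \<Longrightarrow> R X \<in> fibrant_objects A CoFib Weq"
    and q_TFib: "X \<in> Obj A \<Longrightarrow> q X \<in> Fib \<inter> Weq"
    and q_Hom: "X \<in> Obj A \<Longrightarrow> q X \<in> Hom A (Q X) X"
    and r_TCoFib: "X \<in> Obj A \<Longrightarrow> r X \<in> CoFib \<inter> Weq"
    and r_Hom: "X \<in> Obj A \<Longrightarrow> r X \<in> Hom A (Q X) (R X)"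
begin

text \<open>A morphism of spans from \<open>X \<leftarrow> Q X \<rightarrow> R X\<close> to
  \<open>Y \<leftarrow> Q Y \<rightarrow> R Y\<close> with component \<open>f\<close> at the left
  end. As a relation it allows the value of the replacement at \<open>f\<close> to be identified by
  exhibiting any such morphism.\<close>

definition replaces where
  "replaces X Y f h g \<longleftrightarrow> h \<in> Hom A (Q X) (Q Y) \<and> g \<in> Hom A (R X) (R Y) \<and>
     q Y \<cdot>\<^bsub>A\<^esub> h = f \<cdot>\<^bsub>A\<^esub> q X \<and> g \<cdot>\<^bsub>A\<^esub> r X = r Y \<cdot>\<^bsub>A\<^esub> h"

definition replacement where
  "replacement = \<lparr>on_Obj = R, on_Arr = (\<lambda>f. THE g. \<exists>h. replaces (Dom A f) (Cod A f) f h g)\<rparr>"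

lemma R_bifibrant: "X \<in> Obj A \<Longrightarrow> R X \<in> bifibrant"
  using TCoFib_cofibrant[OF r_TCoFib r_Hom Q] R by blast

text \<open>Cofibrancy of \<open>Q X\<close> lifts through the trivial fibration \<open>q Y\<close>
  to give \<open>h\<close>; fibrancy of \<open>R Y\<close> then extends along the trivial
  cofibration \<open>r X\<close> to give \<open>g\<close>.\<close>

lemma replaces_exists:
  assumes f: "f \<in> Hom A X Y"
  obtains h g where "replaces X Y f h g"
proof -
  have X: "X \<in> Obj A" and Y: "Y \<in> Obj A" using Hom_Obj[OF f] by auto
  obtain h where h: "h \<in> Hom A (Q X) (Q Y)" "q Y \<cdot>\<^bsub>A\<^esub> h = f \<cdot>\<^bsub>A\<^esub> q X"
    using cofibrant_lift[OF Q[OF X] q_TFib[OF Y] q_Hom[OF Y] Comp_Hom[OF q_Hom[OF X] f]] .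
  obtain g where "g \<in> Hom A (R X) (R Y)" "g \<cdot>\<^bsub>A\<^esub> r X = r Y \<cdot>\<^bsub>A\<^esub> h"
    using fibrant_lift[OF R[OF Y] r_TCoFib[OF X] r_Hom[OF X] Comp_Hom[OF h(1) r_Hom[OF Y]]] .
  then show ?thesis using that h by (auto simp: replaces_def)
qed

lemma replaces_unique:
  assumes f: "f \<in> Hom A X Y" and "replaces X Y f h g" "replaces X Y f h' g'"
  shows "g = g'"
proof -
  have X: "X \<in> Obj A" and Y: "Y \<in> Obj A" using Hom_Obj[OF f] by auto
  have "h = h'"
    using cofibrant_cancel[OF Q[OF X] q_TFib[OF Y] q_Hom[OF Y]] assms by (auto simp: replaces_def)
  then show ?thesis
    using fibrant_cancel[OF R[OF Y] r_TCoFib[OF X] r_Hom[OF X]] assms by (auto simp: replaces_def)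
qed

lemma on_Arr_replacement:
  assumes f: "f \<in> Hom A X Y" and fg: "replaces X Y f h g"
  shows "on_Arr replacement f = g"
proof -
  have "(THE g. \<exists>h. replaces X Y f h g) = g"
    using fg replaces_unique[OF f] by (intro the_equality) blast+
  then show ?thesis using f by (simp add: replacement_def Hom_def)
qed

lemma replaces_replacement:
  assumes f: "f \<in> Hom A X Y"
  obtains h where "replaces X Y f h (on_Arr replacement f)"
  using replaces_exists[OF f] on_Arr_replacement[OF f] by metis

lemma replaces_Id:
  assumes X: "X \<in> Obj A"
  shows "replaces X X (Id A X) (Id A (Q X)) (Id A (R X))"
  using Comp_Id[OF q_Hom[OF X]] Id_Comp[OF q_Hom[OF X]] Comp_Id[OF r_Hom[OF X]]
    Id_Comp[OF r_Hom[OF X]] Hom_Obj[OF r_Hom[OF X]] Id_Hom by (auto simp: replaces_def)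

lemma replaces_Comp:
  assumes f: "f \<in> Hom A X Y" and f': "f' \<in> Hom A Y Z"
    and "replaces X Y f h g" "replaces Y Z f' h' g'"
  shows "replaces X Z (f' \<cdot>\<^bsub>A\<^esub> f) (h' \<cdot>\<^bsub>A\<^esub> h) (g' \<cdot>\<^bsub>A\<^esub> g)"
proof -
  have h: "h \<in> Hom A (Q X) (Q Y)" "q Y \<cdot>\<^bsub>A\<^esub> h = f \<cdot>\<^bsub>A\<^esub> q X"
    and h': "h' \<in> Hom A (Q Y) (Q Z)" "q Z \<cdot>\<^bsub>A\<^esub> h' = f' \<cdot>\<^bsub>A\<^esub> q Y"
    and g: "g \<in> Hom A (R X) (R Y)" "g \<cdot>\<^bsub>A\<^esub> r X = r Y \<cdot>\<^bsub>A\<^esub> h"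
    and g': "g' \<in> Hom A (R Y) (R Z)" "g' \<cdot>\<^bsub>A\<^esub> r Y = r Z \<cdot>\<^bsub>A\<^esub> h'"
    using assms by (auto simp: replaces_def)
  have X: "X \<in> Obj A" and Y: "Y \<in> Obj A" and Z: "Z \<in> Obj A"
    using Hom_Obj[OF f] Hom_Obj[OF f'] by auto
  have "q Z \<cdot>\<^bsub>A\<^esub> (h' \<cdot>\<^bsub>A\<^esub> h) = (f' \<cdot>\<^bsub>A\<^esub> f) \<cdot>\<^bsub>A\<^esub> q X"
    using Comp_assoc[OF h(1) h'(1) q_Hom[OF Z]] Comp_assoc[OF h(1) q_Hom[OF Y] f']
      Comp_assoc[OF q_Hom[OF X] f f'] by (simp add: h h')
  moreover have "(g' \<cdot>\<^bsub>A\<^esub> g) \<cdot>\<^bsub>A\<^esub> r X = r Z \<cdot>\<^bsub>A\<^esub> (h' \<cdot>\<^bsub>A\<^esub> h)"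
    using Comp_assoc[OF h(1) h'(1) r_Hom[OF Z]] Comp_assoc[OF h(1) r_Hom[OF Y] g'(1)]
      Comp_assoc[OF r_Hom[OF X] g(1) g'(1)] by (simp add: g g')
  ultimately show ?thesis
    using Comp_Hom[OF h(1) h'(1)] Comp_Hom[OF g(1) g'(1)] by (simp add: replaces_def)
qed

text \<open>Two-out-of-three moves along the span: the square with \<open>q\<close> passes the
  property from \<open>f\<close> to \<open>h\<close>, and the square with \<open>r\<close> passes it
  from \<open>h\<close> to \<open>g\<close>.\<close>

lemma replaces_Weq:
  assumes f: "f \<in> Hom A X Y" "f \<in> Weq" and fg: "replaces X Y f h g"
  shows "g \<in> Weq"
proof -
  have h: "h \<in> Hom A (Q X) (Q Y)" "q Y \<cdot>\<^bsub>A\<^esub> h = f \<cdot>\<^bsub>A\<^esub> q X"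
    and g: "g \<in> Hom A (R X) (R Y)" "g \<cdot>\<^bsub>A\<^esub> r X = r Y \<cdot>\<^bsub>A\<^esub> h"
    using fg by (auto simp: replaces_def)
  have X: "X \<in> Obj A" and Y: "Y \<in> Obj A" using Hom_Obj[OF f(1)] by auto
  have "h \<in> Weq"
    using Weq_cancel_left[OF h(1) q_Hom[OF Y]] Weq_comp[OF q_Hom[OF X] f(1)]
      q_TFib[OF X] q_TFib[OF Y] f(2) h(2) by auto
  then show ?thesis
    using Weq_cancel_right[OF r_Hom[OF X] g(1)] Weq_comp[OF h(1) r_Hom[OF Y]]
      r_TCoFib[OF X] r_TCoFib[OF Y] g(2) by auto
qed

text \<open>The functor laws follow from uniqueness: identities and composites of span morphisms are
  again span morphisms, so they give the values of the replacement.\<close>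

lemma is_functor_replacement: "is_functor A (full_subcategory A bifibrant) replacement"
proof (intro is_functor.intro is_functor_axioms.intro category_axioms category_full_subcategory)
  fix X assume X: "X \<in> Obj A"
  then show "on_Obj replacement X \<in> Obj (full_subcategory A bifibrant)"
    using R_bifibrant[OF X] Hom_Obj[OF r_Hom[OF X]]
    by (simp add: full_subcategory_simps replacement_def)
  show "on_Arr replacement (Id A X) = Id (full_subcategory A bifibrant) (on_Obj replacement X)"
    using on_Arr_replacement[OF Id_Hom[OF X] replaces_Id[OF X]]
    by (simp add: full_subcategory_simps) (simp add: replacement_def)
next
  fix f X Y assume f: "f \<in> Hom A X Y"
  then obtain h where fh: "replaces X Y f h (on_Arr replacement f)" by (rule replaces_replacement)
  then show "on_Arr replacement f
      \<in> Hom (full_subcategory A bifibrant) (on_Obj replacement X) (on_Obj replacement Y)"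
    using Hom_Obj[OF f] R_bifibrant
    by (simp add: Hom_full_subcategory replaces_def) (simp add: replacement_def)
  fix f' Z assume f': "f' \<in> Hom A Y Z"
  then obtain h' where "replaces Y Z f' h' (on_Arr replacement f')" by (rule replaces_replacement)
  then show "on_Arr replacement (f' \<cdot>\<^bsub>A\<^esub> f)
      = on_Arr replacement f' \<cdot>\<^bsub>full_subcategory A bifibrant\<^esub> on_Arr replacement f"
    using on_Arr_replacement[OF Comp_Hom[OF f f'] replaces_Comp[OF f f' fh]]
    by (simp add: full_subcategory_simps)
qed

text \<open>The image of a weak equivalence is a weak equivalence between bifibrant objects, hence
  invertible in \<open>A\<close>, and by fullness also in the subcategory.\<close>

lemma inverting_functor_replacement:
  "inverting_functor A Weq (full_subcategory A bifibrant) replacement"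
proof (intro inverting_functor.intro localizing_Weq is_functor_replacement
    inverting_functor_axioms.intro)
  fix w assume w: "w \<in> Weq"
  then have wH: "w \<in> Hom A (Dom A w) (Cod A w)" using Weq_Arr by (auto simp: Hom_def)
  obtain h where h: "replaces (Dom A w) (Cod A w) w h (on_Arr replacement w)"
    using replaces_replacement[OF wH] .
  have g: "on_Arr replacement w \<in> Hom A (R (Dom A w)) (R (Cod A w))"
    using h by (simp add: replaces_def)
  have bif: "R (Dom A w) \<in> bifibrant" "R (Cod A w) \<in> bifibrant"
    using R_bifibrant Hom_Obj[OF wH] by blast+
  show "is_iso (full_subcategory A bifibrant) (on_Arr replacement w)"
    using is_iso_full_subcategory[OF g bif] Weq_bifibrant_iso[OF g replaces_Weq[OF wH w h] bif] .
qed

section \<open>Unit and counit\<close>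

lemma unit_natural:
  obtains \<eta> where
    "\<And>X. X \<in> Obj A \<inter> bifibrant \<Longrightarrow> \<eta> X \<in> Hom A X (R X) \<and> is_iso A (\<eta> X)"
    "\<And>f X Y. f \<in> Hom A X Y \<Longrightarrow> X \<in> bifibrant \<Longrightarrow> Y \<in> bifibrant \<Longrightarrow>
      \<eta> Y \<cdot>\<^bsub>A\<^esub> f = on_Arr replacement f \<cdot>\<^bsub>A\<^esub> \<eta> X"
proof -
  \<comment> \<open>As \<open>X\<close> is cofibrant, \<open>q X\<close> has a section
    \<open>v X\<close>, a weak equivalence by two-out-of-three. The unit at \<open>X\<close> is
    \<open>r X\<close> after \<open>v X\<close>, a weak equivalence between bifibrant objects and
    therefore an isomorphism.\<close>
  have "\<exists>v. v \<in> Hom A X (Q X) \<and> q X \<cdot>\<^bsub>A\<^esub> v = Id A X" if "X \<in> Obj A \<inter> bifibrant" for X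
    using cofibrant_lift[OF _ q_TFib q_Hom Id_Hom] that by blast
  then obtain v where v: "v X \<in> Hom A X (Q X)" "q X \<cdot>\<^bsub>A\<^esub> v X = Id A X"
    if "X \<in> Obj A \<inter> bifibrant" for X by metis
  have v_Weq: "v X \<in> Weq" if X: "X \<in> Obj A \<inter> bifibrant" for X
    using Weq_cancel_left[OF v(1)[OF X] q_Hom] q_TFib Weq_Id v(2)[OF X] X by auto
  have iso: "r X \<cdot>\<^bsub>A\<^esub> v X \<in> Hom A X (R X) \<and> is_iso A (r X \<cdot>\<^bsub>A\<^esub> v X)"
    if X: "X \<in> Obj A \<inter> bifibrant" for X
  proof -
    have XO: "X \<in> Obj A" using X by simp
    have "r X \<cdot>\<^bsub>A\<^esub> v X \<in> Weq"
      using Weq_comp[OF v(1)[OF X] r_Hom[OF XO] v_Weq[OF X]] r_TCoFib[OF XO] by simp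
    moreover have H: "r X \<cdot>\<^bsub>A\<^esub> v X \<in> Hom A X (R X)" using Comp_Hom[OF v(1)[OF X] r_Hom[OF XO]] .
    ultimately show ?thesis using Weq_bifibrant_iso[OF H] X R_bifibrant[OF XO] by blast
  qed
  have nat: "(r Y \<cdot>\<^bsub>A\<^esub> v Y) \<cdot>\<^bsub>A\<^esub> f = on_Arr replacement f \<cdot>\<^bsub>A\<^esub> (r X \<cdot>\<^bsub>A\<^esub> v X)"
    if f: "f \<in> Hom A X Y" and bif: "X \<in> bifibrant" "Y \<in> bifibrant" for f X Y
  proof -
    have X: "X \<in> Obj A" and Y: "Y \<in> Obj A" using Hom_Obj[OF f] by auto
    have vX: "v X \<in> Hom A X (Q X)" "q X \<cdot>\<^bsub>A\<^esub> v X = Id A X"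
      and vY: "v Y \<in> Hom A Y (Q Y)" "q Y \<cdot>\<^bsub>A\<^esub> v Y = Id A Y" using v X Y bif by auto
    obtain h where "replaces X Y f h (on_Arr replacement f)" using replaces_replacement[OF f] .
    then have h: "h \<in> Hom A (Q X) (Q Y)" "q Y \<cdot>\<^bsub>A\<^esub> h = f \<cdot>\<^bsub>A\<^esub> q X"
      and g: "on_Arr replacement f \<in> Hom A (R X) (R Y)"
        "on_Arr replacement f \<cdot>\<^bsub>A\<^esub> r X = r Y \<cdot>\<^bsub>A\<^esub> h"
      by (auto simp: replaces_def)
    \<comment> \<open>Both sides equal \<open>f\<close>, because \<open>v X\<close> and
      \<open>v Y\<close> are sections; cofibrancy of \<open>X\<close> then cancels
      \<open>q Y\<close>.\<close>
    have "q Y \<cdot>\<^bsub>A\<^esub> (v Y \<cdot>\<^bsub>A\<^esub> f) = q Y \<cdot>\<^bsub>A\<^esub> (h \<cdot>\<^bsub>A\<^esub> v X)"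
      using Comp_assoc[OF f vY(1) q_Hom[OF Y]] Comp_assoc[OF vX(1) h(1) q_Hom[OF Y]]
        Comp_assoc[OF vX(1) q_Hom[OF X] f] Comp_Id[OF f] Id_Comp[OF f] by (simp add: vX vY h)
    then have "v Y \<cdot>\<^bsub>A\<^esub> f = h \<cdot>\<^bsub>A\<^esub> v X"
      using cofibrant_cancel[OF _ q_TFib[OF Y] q_Hom[OF Y] Comp_Hom[OF f vY(1)] Comp_Hom[OF vX(1) h(1)]]
        bif by blast
    then show ?thesis
      using Comp_assoc[OF f vY(1) r_Hom[OF Y]] Comp_assoc[OF vX(1) h(1) r_Hom[OF Y]]
        Comp_assoc[OF vX(1) r_Hom[OF X] g(1)] by (simp add: g)
  qed
  show ?thesis using that[of "\<lambda>X. r X \<cdot>\<^bsub>A\<^esub> v X"] iso nat by blast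
qed

text \<open>A functor inverting weak equivalences inverts both legs of
  \<open>X \<leftarrow> Q X \<rightarrow> R X\<close>; going back along \<open>r X\<close> and then
  along \<open>q X\<close> gives the component at \<open>X\<close>. It is later applied to the
  localization functor.\<close>

lemma counit_natural:
  assumes F: "is_functor A B F" and inv: "\<And>w. w \<in> Weq \<Longrightarrow> is_iso B (on_Arr F w)"
  obtains \<epsilon> where
    "\<And>X. X \<in> Obj A \<Longrightarrow> \<epsilon> X \<in> Hom B (on_Obj F (R X)) (on_Obj F X) \<and> is_iso B (\<epsilon> X)"
    "\<And>f X Y. f \<in> Hom A X Y \<Longrightarrow>
      \<epsilon> Y \<cdot>\<^bsub>B\<^esub> on_Arr F (on_Arr replacement f) = on_Arr F f \<cdot>\<^bsub>B\<^esub> \<epsilon> X"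
proof -
  interpret F: is_functor A B F by (rule F)
  have "\<exists>t. inverse_pair B (on_Arr F (r X)) t" if "X \<in> Obj A" for X
    using inv r_TCoFib[OF that] by (auto simp: is_iso_def)
  then obtain t where t: "inverse_pair B (on_Arr F (r X)) (t X)" if "X \<in> Obj A" for X by metis
  note Fq = F.on_Arr_Hom[OF q_Hom] and Fr = F.on_Arr_Hom[OF r_Hom]
  have tH: "t X \<in> Hom B (on_Obj F (R X)) (on_Obj F (Q X))" if "X \<in> Obj A" for X
    using t[OF that] inverse_pair_Hom_iff[OF Fr[OF that]] by blast
  have iso: "on_Arr F (q X) \<cdot>\<^bsub>B\<^esub> t X \<in> Hom B (on_Obj F (R X)) (on_Obj F X) \<and>
      is_iso B (on_Arr F (q X) \<cdot>\<^bsub>B\<^esub> t X)" if X: "X \<in> Obj A" for X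
  proof -
    obtain s where "inverse_pair B (on_Arr F (q X)) s"
      using inv q_TFib[OF X] by (auto simp: is_iso_def)
    then show ?thesis
      using F.B.inverse_pair_comp[OF tH[OF X] Fq[OF X] inverse_pair_sym[OF t[OF X]]]
        F.B.Comp_Hom[OF tH[OF X] Fq[OF X]] by (auto simp: is_iso_def)
  qed
  have nat: "(on_Arr F (q Y) \<cdot>\<^bsub>B\<^esub> t Y) \<cdot>\<^bsub>B\<^esub> on_Arr F (on_Arr replacement f)
      = on_Arr F f \<cdot>\<^bsub>B\<^esub> (on_Arr F (q X) \<cdot>\<^bsub>B\<^esub> t X)" if f: "f \<in> Hom A X Y" for f X Y
  proof -
    have X: "X \<in> Obj A" and Y: "Y \<in> Obj A" using Hom_Obj[OF f] by auto
    obtain h where "replaces X Y f h (on_Arr replacement f)" using replaces_replacement[OF f] .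
    then have h: "h \<in> Hom A (Q X) (Q Y)" "q Y \<cdot>\<^bsub>A\<^esub> h = f \<cdot>\<^bsub>A\<^esub> q X"
      and g: "on_Arr replacement f \<in> Hom A (R X) (R Y)"
        "on_Arr replacement f \<cdot>\<^bsub>A\<^esub> r X = r Y \<cdot>\<^bsub>A\<^esub> h"
      by (auto simp: replaces_def)
    note Ff = F.on_Arr_Hom[OF f] and Fh = F.on_Arr_Hom[OF h(1)] and Fg = F.on_Arr_Hom[OF g(1)]
    have sq: "on_Arr F (q Y) \<cdot>\<^bsub>B\<^esub> on_Arr F h = on_Arr F f \<cdot>\<^bsub>B\<^esub> on_Arr F (q X)"
      "on_Arr F (on_Arr replacement f) \<cdot>\<^bsub>B\<^esub> on_Arr F (r X) = on_Arr F (r Y) \<cdot>\<^bsub>B\<^esub> on_Arr F h"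
      using F.on_Arr_Comp[OF h(1) q_Hom[OF Y]] F.on_Arr_Comp[OF q_Hom[OF X] f]
        F.on_Arr_Comp[OF h(1) r_Hom[OF Y]] F.on_Arr_Comp[OF r_Hom[OF X] g(1)] h g by simp_all
    \<comment> \<open>The square relating \<open>g\<close> and \<open>h\<close>, with its sides
      \<open>r X\<close> and \<open>r Y\<close> inverted under \<open>F\<close>; it remains to paste
      the square of \<open>q\<close>.\<close>
    have "t Y \<cdot>\<^bsub>B\<^esub> on_Arr F (on_Arr replacement f)
        = t Y \<cdot>\<^bsub>B\<^esub> ((on_Arr F (r Y) \<cdot>\<^bsub>B\<^esub> on_Arr F h) \<cdot>\<^bsub>B\<^esub> t X)"
      using F.B.cancel_inverse_right[OF Fr[OF X] t[OF X] Fg] sq(2) by simp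
    also have "\<dots> = on_Arr F h \<cdot>\<^bsub>B\<^esub> t X"
      using F.B.Comp_assoc[OF tH[OF X] Fh Fr[OF Y]]
        F.B.cancel_inverse_left[OF Fr[OF Y] t[OF Y] F.B.Comp_Hom[OF tH[OF X] Fh]] by simp
    finally show ?thesis
      using F.B.Comp_assoc[OF Fg tH[OF Y] Fq[OF Y]] F.B.Comp_assoc[OF tH[OF X] Fh Fq[OF Y]]
        F.B.Comp_assoc[OF tH[OF X] Fq[OF X] Ff] sq(1) by simp
  qed
  show ?thesis using that[of "\<lambda>X. on_Arr F (q X) \<cdot>\<^bsub>B\<^esub> t X"] iso nat by blast
qed

section \<open>Descent to the homotopy category and the equivalence\<close>

lemma bifibrant_equivalence_Ho:
  "is_equivalence (full_subcategory A bifibrant) (Ho A Weq) (localization_functor A Weq)"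
proof -
  interpret L: localizing A Weq by (rule localizing_Weq)
  interpret H: category "localization A Weq" by (rule L.category_localization)
  interpret P: inverting_functor A Weq "full_subcategory A bifibrant" replacement
    by (rule inverting_functor_replacement)
  let ?L = "localization_functor A Weq" and ?B = "full_subcategory A bifibrant"
    and ?H = "localization A Weq"
  interpret LF: is_functor A ?H ?L by (rule L.is_functor_localization)
  have LB: "is_functor ?B ?H ?L" by (rule LF.is_functor_full_subcategory)
  have L_Obj: "on_Obj ?L X = X" for X by (simp add: localization_functor_def)
  \<comment> \<open>The quasi-inverse comes from the universal property of the localization, as the
    replacement functor inverts \<open>Weq\<close>.\<close>
  obtain G where G: "is_functor ?H ?B G"
    and G_Obj: "\<And>X. X \<in> Obj A \<Longrightarrow> on_Obj G X = R X"
    and G_Arr: "\<And>f. f \<in> Arr A \<Longrightarrow> on_Arr G (on_Arr ?L f) = on_Arr replacement f"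
    using P.localization_factor by (auto simp: comp_functor_def L_Obj replacement_def)
  obtain \<eta> where \<eta>: "\<And>X. X \<in> Obj A \<inter> bifibrant \<Longrightarrow> \<eta> X \<in> Hom A X (R X) \<and> is_iso A (\<eta> X)"
    "\<And>f X Y. f \<in> Hom A X Y \<Longrightarrow> X \<in> bifibrant \<Longrightarrow> Y \<in> bifibrant \<Longrightarrow>
      \<eta> Y \<cdot>\<^bsub>A\<^esub> f = on_Arr replacement f \<cdot>\<^bsub>A\<^esub> \<eta> X"
    using unit_natural by blast
  have "natural_isomorphism ?B ?B id_functor (comp_functor G ?L) \<eta>"
    unfolding natural_isomorphism_def
  proof (intro conjI ballI category.is_functor_id category_full_subcategory is_functor_comp[OF LB G])
    fix X assume "X \<in> Obj ?B"
    then have X: "X \<in> Obj A" "X \<in> bifibrant" by (auto simp: full_subcategory_simps)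
    then show "\<eta> X \<in> Hom ?B (on_Obj id_functor X) (on_Obj (comp_functor G ?L) X)"
      using \<eta>(1)[of X] R_bifibrant[OF X(1)] G_Obj[OF X(1)]
      by (simp add: Hom_full_subcategory id_functor_def comp_functor_def L_Obj)
    show "is_iso ?B (\<eta> X)"
      using is_iso_full_subcategory[of "\<eta> X" A X "R X" bifibrant] \<eta>(1)[of X] X R_bifibrant[OF X(1)]
      by blast
  next
    fix f assume "f \<in> Arr ?B"
    then have f: "f \<in> Hom A (Dom A f) (Cod A f)" "Dom A f \<in> bifibrant" "Cod A f \<in> bifibrant"
      by (auto simp: full_subcategory_def Hom_def)
    have "f \<in> Arr A" using f(1) by (simp add: Hom_def)
    then show "\<eta> (Cod ?B f) \<cdot>\<^bsub>?B\<^esub> on_Arr id_functor f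
        = on_Arr (comp_functor G ?L) f \<cdot>\<^bsub>?B\<^esub> \<eta> (Dom ?B f)"
      using \<eta>(2)[OF f] by (simp add: full_subcategory_def id_functor_def comp_functor_def G_Arr)
  qed
  moreover
  have L_inv: "is_iso ?H (on_Arr ?L w)" if "w \<in> Weq" for w
    using L.localization_inverse_pair[OF that] unfolding is_iso_def by blast
  \<comment> \<open>At this point naturality is known only at images of arrows of
    \<open>A\<close>.\<close>
  obtain \<epsilon> where \<epsilon>: "\<And>X. X \<in> Obj A \<Longrightarrow> \<epsilon> X \<in> Hom ?H (R X) X \<and> is_iso ?H (\<epsilon> X)"
    "\<And>f X Y. f \<in> Hom A X Y \<Longrightarrow>
      \<epsilon> Y \<cdot>\<^bsub>?H\<^esub> on_Arr ?L (on_Arr replacement f) = on_Arr ?L f \<cdot>\<^bsub>?H\<^esub> \<epsilon> X"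
    using counit_natural[OF L.is_functor_localization L_inv] unfolding L_Obj by blast
  have LG: "is_functor ?H ?H (comp_functor ?L G)" by (rule is_functor_comp[OF G LB])
  have \<epsilon>H: "\<epsilon> X \<in> Hom ?H (on_Obj (comp_functor ?L G) X) (on_Obj id_functor X)"
    if "X \<in> Obj A" for X
    using \<epsilon>(1)[OF that] by (simp add: id_functor_def comp_functor_def L_Obj G_Obj[OF that])
  have "natural_isomorphism ?H ?H (comp_functor ?L G) id_functor \<epsilon>"
    unfolding natural_isomorphism_def
  proof (intro conjI ballI H.is_functor_id LG)
    fix X assume "X \<in> Obj ?H"
    then have X: "X \<in> Obj A" by (simp add: L.Obj_localization)
    show "\<epsilon> X \<in> Hom ?H (on_Obj (comp_functor ?L G) X) (on_Obj id_functor X)" using \<epsilon>H[OF X] .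
    show "is_iso ?H (\<epsilon> X)" using \<epsilon>(1)[OF X] by simp
  next
    \<comment> \<open>An arbitrary arrow of the homotopy category is a zigzag class, so
      \<open>localization_naturality\<close> is needed to reach it.\<close>
    fix a assume "a \<in> Arr ?H"
    then have a: "a \<in> Hom ?H (Dom ?H a) (Cod ?H a)" by (simp add: Hom_def)
    show "\<epsilon> (Cod ?H a) \<cdot>\<^bsub>?H\<^esub> on_Arr (comp_functor ?L G) a
        = on_Arr id_functor a \<cdot>\<^bsub>?H\<^esub> \<epsilon> (Dom ?H a)"
      using L.localization_naturality[OF LG H.is_functor_id \<epsilon>H _ a] \<epsilon>(2) G_Arr
      by (simp add: id_functor_def comp_functor_def Hom_def)
  qed
  ultimately show ?thesis using LB G unfolding is_equivalence_def Ho_def by blast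
qed

end

theorem theoremA:
  fixes A :: "('o, 'm) cat" and CoFib Fib Weq :: "'m set"
  assumes "orthogonal_model_structure A CoFib Fib Weq"
    and "enough_cofibrant_objects A Fib Weq"
    and "enough_fibrant_objects A CoFib Weq"
  shows "is_equivalence
    (full_subcategory A (cofibrant_objects A Fib Weq \<inter> fibrant_objects A CoFib Weq))
    (Ho A Weq) (localization_functor A Weq)"
proof -
  interpret orthogonal_model_structure A CoFib Fib Weq by (rule assms(1))
  obtain Q q where Q: "Q X \<in> cofibrant_objects A Fib Weq \<and> q X \<in> Fib \<inter> Weq \<and> q X \<in> Hom A (Q X) X"
    if "X \<in> Obj A" for X
    using assms(2) unfolding enough_cofibrant_objects_def by metis
  \<comment> \<open>Enough fibrant objects is applied to \<open>Q X\<close>, not to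
    \<open>X\<close>, to get the second leg of the span.\<close>
  have "\<exists>F i. F \<in> fibrant_objects A CoFib Weq \<and> i \<in> CoFib \<inter> Weq \<and> i \<in> Hom A (Q X) F"
    if "X \<in> Obj A" for X
    using assms(3) Q[OF that] Hom_Obj unfolding enough_fibrant_objects_def by metis
  then obtain R r where "R X \<in> fibrant_objects A CoFib Weq \<and> r X \<in> CoFib \<inter> Weq \<and>
      r X \<in> Hom A (Q X) (R X)" if "X \<in> Obj A" for X by metis
  then have "bifibrant_replacement A CoFib Fib Weq Q R q r"
    using Q by unfold_locales auto
  then show ?thesis by (rule bifibrant_replacement.bifibrant_equivalence_Ho)
qed

end
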